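(* Let $0\le m\le n$ be integers and let $K_m(x,y)$ be the multivariable Christoffel--Darboux kernel associated with the given linear functional. Then, as an identity of rational functions in $x=(x_1,\dots,x_m)$, $$K_m(x,x)=\frac{(-1)^{\frac12m(m-1)}}{\prod_{i=1}^m\langle p_{n-i},p_{n-i}\rangle\;\Delta(x)^4}\;\det_{1\le i,j\le 2m}(A_{ij}),$$ where $$A_{ij}=\begin{cases}p_{n-m+j-1}(x_i), & 1\le i\le m,\\ p_{n-m+j-1}'(x_{i-m}), & m+1\le i\le 2m,\end{cases}$$ and $p_k'$ denotes the derivative of $p_k$.
   Context: Scalars are complex. Let $f\mapsto\int f(x)\,d\mu(x)$ be a linear functional on polynomials in one variable. For $n\ge1$ let $V_n$ be the space of one-variable polynomials of degree at most $n-1$, and assume that the bilinear pairing $\langle f,g\rangle=\int f(x)g(x)\,d\mu(x)$ is non-degenerate on each $V_n$. Let $(p_k)_{k\ge0}$ be the corresponding monic orthogonal polynomials ($\deg p_k=k$). Let $K(x,y)=\sum_{k=0}^{n-1}\frac{p_k(x)p_k(y)}{\langle p_k,p_k\rangle}$ (depending on $n$). For $x=(x_1,\dots,x_m)$ put $\Delta(x)=\prod_{1\le i<j\le m}(x_j-x_i)$. Let $V_n^m$ ($0\le m\le n$) be the space of antisymmetric polynomials in $x_1,\dots,x_m$ of degree at most $n-1$ in each $x_i$. Write $\int f(x)\,d\mu_m(x)=\frac1{m!}\int f(x_1,\dots,x_m)\,d\mu(x_1)\cdots d\mu(x_m)$, where the functional is applied in each variable separately. The kernel $K_m(x,y)$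 is defined by requiring that $\Delta(x)\Delta(y)K_m(x,y)$ be the reproducing kernel of $V_n^m$, i.e. the unique element of $V_n^m\otimes V_n^m$ such that $f(x)=\int f(y)\Delta(x)\Delta(y)K_m(x,y)\,d\mu_m(y)$ for all $f\in V_n^m$. Equivalently, $K_m(x,y)=\frac{\det_{1\le i,j\le m}(K(x_i,y_j))}{\Delta(x)\Delta(y)}$, which is a polynomial; $K_m(x,x)$ is its specialization at $y=x$. Empty products and determinants equal $1$. *)

theory Defs
  imports
    "HOL-Library.Poly_Mapping"
    "HOL-Combinatorics.Permutations"
    "HOL-Computational_Algebra.Computational_Algebra"
    "Jordan_Normal_Form.Determinant"
begin

definition linear_functional :: "(complex poly \<Rightarrow> complex) \<Rightarrow> bool" where
  "linear_functional L \<longleftrightarrow> Vector_Spaces.linear Polynomial.smult (*) L"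

definition pairing :: "(complex poly \<Rightarrow> complex) \<Rightarrow> complex poly \<Rightarrow> complex poly \<Rightarrow> complex" where
  "pairing L f g = L (f * g)"

definition poly_space :: "nat \<Rightarrow> complex poly set" where
  "poly_space n = {f. Polynomial.degree f \<le> n - 1}"

text \<open>The pairing is symmetric, so a one-sided condition suffices.\<close>

definition nondegenerate :: "(complex poly \<Rightarrow> complex) \<Rightarrow> bool" where
  "nondegenerate L \<longleftrightarrow>
     (\<forall>n\<ge>1. \<forall>f\<in>poly_space n. (\<forall>g\<in>poly_space n. pairing L f g = 0) \<longrightarrow> f = 0)"

definition monic_orthogonal :: "(complex poly \<Rightarrow> complex) \<Rightarrow> (nat \<Rightarrow> complex poly) \<Rightarrow> bool" where
  "monic_orthogonal L p \<longleftrightarrow>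
     (\<forall>k. Polynomial.degree (p k) = k \<and> lead_coeff (p k) = 1) \<and>
     (\<forall>j k. j \<noteq> k \<longrightarrow> pairing L (p j) (p k) = 0)"

text \<open>
  Polynomials in countably many indeterminates, as finitely supported coefficient functions on
  monomials (exponent vectors). The indeterminates used for \<open>x\<^sub>1, \<dots>, x\<^sub>m\<close> are those with
  indices \<open>0, \<dots>, m - 1\<close>, the ones for \<open>y\<^sub>1, \<dots>, y\<^sub>m\<close> have indices \<open>m, \<dots>, 2 m - 1\<close>.
\<close>

type_synonym cmpoly = "(nat \<Rightarrow>\<^sub>0 nat) \<Rightarrow>\<^sub>0 complex"

definition Var :: "nat \<Rightarrow> cmpoly" where
  "Var i = Poly_Mapping.single (Poly_Mapping.single i 1) 1"

definition Const :: "complex \<Rightarrow> cmpoly" where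
  "Const c = Poly_Mapping.single 0 c"

definition subst :: "(nat \<Rightarrow> cmpoly) \<Rightarrow> cmpoly \<Rightarrow> cmpoly" where
  "subst \<sigma> f = (\<Sum>a\<in>Poly_Mapping.keys f.
     Const (Poly_Mapping.lookup f a) *
     (\<Prod>i\<in>Poly_Mapping.keys a. \<sigma> i ^ Poly_Mapping.lookup a i))"

definition poly_at :: "complex poly \<Rightarrow> nat \<Rightarrow> cmpoly" where
  "poly_at q i = poly (map_poly Const q) (Var i)"

definition vandermonde :: "nat \<Rightarrow> nat \<Rightarrow> cmpoly" where
  "vandermonde s m = (\<Prod>j<m. \<Prod>i<j. Var (s + j) - Var (s + i))"

definition shift_vars :: "nat \<Rightarrow> cmpoly \<Rightarrow> cmpoly" where
  "shift_vars s = subst (\<lambda>i. Var (s + i))"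

text \<open>The specialization \<open>y = x\<close>.\<close>

definition diag :: "nat \<Rightarrow> cmpoly \<Rightarrow> cmpoly" where
  "diag m = subst (\<lambda>i. if i < m then Var i else Var (i - m))"

text \<open>
  Application of \<open>L\<close> in the indeterminate \<open>i\<close>, the others being parameters: a monomial
  \<open>x\<^sub>i\<^sup>e u\<close>, with \<open>u\<close> free of \<open>x\<^sub>i\<close>, is sent to \<open>L (x\<^sup>e) u\<close>.
\<close>

definition apply_var :: "(complex poly \<Rightarrow> complex) \<Rightarrow> nat \<Rightarrow> cmpoly \<Rightarrow> cmpoly" where
  "apply_var L i f = (\<Sum>a\<in>Poly_Mapping.keys f.
     Poly_Mapping.single (Poly_Mapping.update i 0 a)
       (Poly_Mapping.lookup f a * L (Polynomial.monom 1 (Poly_Mapping.lookup a i))))"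

definition multi_functional ::
  "(complex poly \<Rightarrow> complex) \<Rightarrow> nat \<Rightarrow> nat \<Rightarrow> cmpoly \<Rightarrow> cmpoly" where
  "multi_functional L s m f = Const (1 / fact m) * fold (apply_var L) [s..<s + m] f"

text \<open>For \<open>n = m = 0\<close> the degree condition is vacuous, and the space consists of the constants.\<close>

definition antisym_space :: "nat \<Rightarrow> nat \<Rightarrow> cmpoly set" where
  "antisym_space n m = {f.
     (\<forall>a\<in>Poly_Mapping.keys f.
        Poly_Mapping.keys a \<subseteq> {..<m} \<and> (\<forall>i<m. Poly_Mapping.lookup a i \<le> n - 1)) \<and>
     (\<forall>\<pi>. \<pi> permutes {..<m} \<longrightarrow> subst (\<lambda>i. Var (\<pi> i)) f = of_int (sign \<pi>) * f)}"

text \<open>\<open>V \<otimes> V\<close>, realised as the finite sums of products \<open>g(x) h(y)\<close> with \<open>g, h \<in> V\<close>.\<close>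

definition antisym_tensor :: "nat \<Rightarrow> nat \<Rightarrow> cmpoly set" where
  "antisym_tensor n m = {E. \<exists>N g h.
     (\<forall>k<(N::nat). g k \<in> antisym_space n m \<and> h k \<in> antisym_space n m) \<and>
     E = (\<Sum>k<N. g k * shift_vars m (h k))}"

definition reproducing_kernel ::
  "(complex poly \<Rightarrow> complex) \<Rightarrow> nat \<Rightarrow> nat \<Rightarrow> cmpoly \<Rightarrow> bool" where
  "reproducing_kernel L n m E \<longleftrightarrow>
     E \<in> antisym_tensor n m \<and>
     (\<forall>f\<in>antisym_space n m. f = multi_functional L m m (shift_vars m f * E))"

definition CD_kernel :: "(complex poly \<Rightarrow> complex) \<Rightarrow> nat \<Rightarrow> nat \<Rightarrow> cmpoly" where
  "CD_kernel L n m =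
     (THE K. reproducing_kernel L n m (vandermonde 0 m * vandermonde m m * K))"

text \<open>
  Rows and columns are numbered from \<open>0\<close>, so column \<open>j\<close> belongs to \<open>p\<^bsub>n-m+j\<^esub>\<close>;
  \<open>n - m\<close> is only meant for \<open>m \<le> n\<close>.
\<close>

definition confluent_matrix :: "(nat \<Rightarrow> complex poly) \<Rightarrow> nat \<Rightarrow> nat \<Rightarrow> cmpoly mat" where
  "confluent_matrix p n m = mat (2 * m) (2 * m) (\<lambda>(i, j).
     if i < m then poly_at (p (n - m + j)) i
     else poly_at (Polynomial.pderiv (p (n - m + j))) (i - m))"

end

theory Submission
  imports Defs "Jordan_Normal_Form.Char_Poly"
begin

text \<open>
  Everything rests on one determinantal identity. With \<open>x\<close> and \<open>y\<close> two independent groups of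
  \<open>m\<close> variables and \<open>z = (x, y)\<close>,
  \<open>(\<Prod>\<^sub>i \<langle>p\<^bsub>n-i\<^esub>, p\<^bsub>n-i\<^esub>\<rangle>)\<^bsup>-1\<^esup> det (p\<^bsub>n-m+j\<^esub>(z\<^sub>i)) = \<Prod>\<^bsub>k,l\<^esub> (y\<^sub>k - x\<^sub>l) det (K(x\<^sub>i, y\<^sub>k))\<close>,
  where the first determinant has size \<open>2 m\<close>, with \<open>j = 0, \<dots>, 2 m - 1\<close>, and the second has size \<open>m\<close>.

  The reason is a multivariable form of the Christoffel--Darboux argument. Put
  \<open>X(t) = \<Prod>\<^sub>l (t - x\<^sub>l)\<close>. The polynomial \<open>X(t) K(x\<^sub>i, t)\<close> has degree below \<open>n + m\<close>, and it is orthogonal to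
  every \<open>q\<close> of degree below \<open>n - m\<close>, because pairing with \<open>K(x\<^sub>i, \<cdot>)\<close> evaluates \<open>X q\<close> at \<open>x\<^sub>i\<close>, where \<open>X\<close>
  vanishes. So it is a combination of exactly the \<open>2 m\<close> polynomials \<open>p\<^bsub>n-m\<^esub>, \<dots>, p\<^bsub>n+m-1\<^esub>\<close> that
  occur in the big determinant. Completing the \<open>m\<close> coefficient rows by \<open>m\<close> unit rows and multiplying
  with the matrix \<open>(p\<^bsub>n-m+j\<^esub>(z\<^sub>k))\<close> produces a block triangular matrix with diagonal blocks
  \<open>(p\<^bsub>n-m+j\<^esub>(x\<^sub>k))\<close> and \<open>(X(y\<^sub>k) K(x\<^sub>i, y\<^sub>k))\<close>; comparing determinants gives the identity
  (\<open>kernel_det_identity\<close>, \<open>christoffel_darboux\<close>).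

  The second ingredient identifies \<open>\<Delta>(x) \<Delta>(y) K\<^sub>m(x, y)\<close> with \<open>det (K(x\<^sub>i, y\<^sub>k))\<close>. By the
  Cauchy--Binet formula this determinant is a sum of products \<open>D\<^sub>\<phi>(x) D\<^sub>\<phi>(y)\<close> of alternants
  \<open>D\<^sub>\<phi> = det (p\<^bsub>\<phi> i\<^esub>(x\<^sub>j))\<close> (\<open>antisym_kernel_as_det\<close>). In this form it visibly lies in the tensor square of the
  antisymmetric space and is divisible by both Vandermonde products, and it reproduces because antisymmetric
  polynomials expand in the \<open>D\<^sub>\<phi>\<close> (\<open>slater_expansion\<close>). A reproducing kernel is unique
  (\<open>reproducing_kernel_unique\<close>), which gives the factorisation \<open>CD_kernel_factor\<close>.

  Finally \<open>y\<close> is specialised to \<open>x\<close>. Subtracting row \<open>x\<^sub>i\<close> from row \<open>y\<^sub>i\<close> extracts the factor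
  \<open>\<Prod>\<^sub>i (y\<^sub>i - x\<^sub>i)\<close> from the big determinant and leaves rows of divided differences, which become derivatives
  at \<open>y = x\<close> (\<open>det_confluent\<close>). After cancelling this factor, the remaining factors
  \<open>\<Prod>\<^bsub>k\<noteq>l\<^esub> (y\<^sub>k - x\<^sub>l)\<close> specialise to \<open>(-1)\<^bsup>m(m-1)/2\<^esup> \<Delta>(x)\<^sup>2\<close>, which is where the sign and two of the four
  powers of \<open>\<Delta>(x)\<close> come from.
\<close>

section \<open>Determinants with columns indexed by points\<close>

text \<open>
  Newton interpolation at the nodes \<open>x\<^sub>0, \<dots>, x\<^bsub>m-1\<^esub>\<close>; the remainder vanishes at all of them.
\<close>

lemma newton_expansion:
  fixes f :: "'a::comm_ring_1 poly" and x :: "nat \<Rightarrow> 'a"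
  shows "\<exists>d r. f = (\<Sum>k<m. Polynomial.smult (d k) (\<Prod>l<k. [:- x l, 1:])) + (\<Prod>l<m. [:- x l, 1:]) * r"
proof (induction m)
  case 0
  show ?case by (rule exI[of _ "\<lambda>_. 0"], rule exI[of _ f]) simp
next
  case (Suc m)
  then obtain d r where dr: "f = (\<Sum>k<m. Polynomial.smult (d k) (\<Prod>l<k. [:- x l, 1:])) + (\<Prod>l<m. [:- x l, 1:]) * r"
    by blast
  obtain s where s: "r = [:poly r (x m):] + [:- x m, 1:] * s"
    using synthetic_div_correct'[of "x m" r] by (metis add.commute)
  define d' where "d' = d(m := poly r (x m))"
  have "f = (\<Sum>k<m. Polynomial.smult (d k) (\<Prod>l<k. [:- x l, 1:])) + (\<Prod>l<m. [:- x l, 1:]) * ([:poly r (x m):] + [:- x m, 1:] * s)"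
    using dr s by metis
  also have "(\<Sum>k<m. Polynomial.smult (d k) (\<Prod>l<k. [:- x l, 1:])) = (\<Sum>k<m. Polynomial.smult (d' k) (\<Prod>l<k. [:- x l, 1:]))"
    by (intro sum.cong) (auto simp: d'_def)
  finally have "f = (\<Sum>k<Suc m. Polynomial.smult (d' k) (\<Prod>l<k. [:- x l, 1:])) + (\<Prod>l<Suc m. [:- x l, 1:]) * s"
    by (simp add: d'_def algebra_simps)
  then show ?case by blast
qed

text \<open>
  Newton interpolation factors the matrix into the coefficients \<open>d\<^sub>i\<^sub>k\<close> and the values at the nodes of
  the Newton basis. The latter matrix is triangular, and its determinant is the Vandermonde product. This yields the
  quotient directly, without any appeal to unique factorisation.
\<close>

lemma vandermonde_dvd_det:
  fixes x :: "nat \<Rightarrow> 'a::comm_ring_1"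
  shows "(\<Prod>j<m. \<Prod>i<j. x j - x i) dvd det (mat m m (\<lambda>(i, j). poly (f i) (x j)))"
proof -
  have "\<forall>i. \<exists>d. \<exists>r. f i = (\<Sum>k<m. Polynomial.smult (d k) (\<Prod>l<k. [:- x l, 1:])) + (\<Prod>l<m. [:- x l, 1:]) * r"
    using newton_expansion by blast
  from choice[OF this] obtain d where d: "\<And>i. \<exists>r. f i = (\<Sum>k<m. Polynomial.smult (d i k) (\<Prod>l<k. [:- x l, 1:])) + (\<Prod>l<m. [:- x l, 1:]) * r"
    by blast
  have val: "poly (f i) (x j) = (\<Sum>k<m. d i k * (\<Prod>l<k. x j - x l))" if "j < m" for i j
  proof -
    obtain r where r: "f i = (\<Sum>k<m. Polynomial.smult (d i k) (\<Prod>l<k. [:- x l, 1:])) + (\<Prod>l<m. [:- x l, 1:]) * r"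
      using d by blast
    have "(\<Prod>l<m. x j - x l) = 0" using that by (intro prod_zero) auto
    then show ?thesis by (subst r) (simp add: poly_sum poly_prod)
  qed
  define M where "M = mat m m (\<lambda>(i, k). d i k)"
  define N where "N = mat m m (\<lambda>(k, j). \<Prod>l<k. x j - x l)"
  have MN: "mat m m (\<lambda>(i, j). poly (f i) (x j)) = M * N"
    by (rule eq_matI) (auto simp: M_def N_def scalar_prod_def val atLeast0LessThan)
  have "upper_triangular N"
    by (auto simp: N_def upper_triangular_def intro!: prod_zero)
  then have "det N = prod_list (diag_mat N)"
    by (intro det_upper_triangular[of N m]) (auto simp: N_def)
  also have "\<dots> = (\<Prod>j<m. \<Prod>i<j. x j - x i)"
    by (simp add: prod_list_diag_prod N_def atLeast0LessThan)
  finally have "det (mat m m (\<lambda>(i, j). poly (f i) (x j))) = det M * (\<Prod>j<m. \<Prod>i<j. x j - x i)"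
    unfolding MN by (subst det_mult[of M m N]) (auto simp: M_def N_def)
  then show ?thesis by simp
qed

lemma PiE_comp_permutes:
  assumes "\<pi> permutes A" and "\<phi> \<in> A \<rightarrow>\<^sub>E B"
  shows "\<phi> \<circ> \<pi> \<in> A \<rightarrow>\<^sub>E B"
  using assms permutes_in_image[OF assms(1)] permutes_not_in[OF assms(1)]
  by (auto simp: PiE_iff extensional_def)

lemma sum_PiE_permute:
  assumes p: "\<pi> permutes A"
  shows "(\<Sum>\<phi>\<in>A \<rightarrow>\<^sub>E B. h (\<phi> \<circ> \<pi>)) = (\<Sum>\<phi>\<in>A \<rightarrow>\<^sub>E B. h \<phi>)"
proof (rule sum.reindex_bij_witness[of _ "\<lambda>\<phi>. \<phi> \<circ> inv_into UNIV \<pi>" "\<lambda>\<phi>. \<phi> \<circ> \<pi>"])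
  fix \<phi> assume f: "\<phi> \<in> A \<rightarrow>\<^sub>E B"
  show "\<phi> \<circ> \<pi> \<in> A \<rightarrow>\<^sub>E B" by (rule PiE_comp_permutes[OF p f])
  show "\<phi> \<circ> inv_into UNIV \<pi> \<in> A \<rightarrow>\<^sub>E B" by (rule PiE_comp_permutes[OF permutes_inv[OF p] f])
qed (simp_all add: comp_assoc permutes_inv_o[OF p])

lemma det_permute_arguments:
  fixes v :: "nat \<Rightarrow> nat \<Rightarrow> 'a::comm_ring_1"
  assumes "\<pi> permutes {..<m}"
  shows "det (mat m m (\<lambda>(i, j). v (\<phi> (\<pi> i)) j)) =
    of_int (sign \<pi>) * det (mat m m (\<lambda>(i, j). v (\<phi> i) j))"
proof -
  have p: "\<pi> permutes {0..<m}" using assms by (simp add: atLeast0LessThan)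
  have "mat m m (\<lambda>(i, j). v (\<phi> (\<pi> i)) j) =
     mat m m (\<lambda>(i, j). mat m m (\<lambda>(i, j). v (\<phi> i) j) $$ (\<pi> i, j))"
    using permutes_in_image[OF p] by (intro eq_matI) auto
  then show ?thesis
    using det_permute_rows[of "mat m m (\<lambda>(i, j). v (\<phi> i) j)" m \<pi>] p by simp
qed

lemma det_rows_as_sum:
  "det (mat m m (\<lambda>(i, j). v (\<phi> i) j)) =
   (\<Sum>\<sigma> | \<sigma> permutes {..<m}. of_int (sign \<sigma>) * (\<Prod>i<m. v (\<phi> i) (\<sigma> i)))"
  by (subst det_def'[of _ m]) (auto simp: atLeast0LessThan permutes_in_image intro!: sum.cong prod.cong)

lemma det_columns_as_sum:
  "det (mat m m (\<lambda>(i, j). v (\<phi> i) j)) =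
   (\<Sum>\<sigma> | \<sigma> permutes {..<m}. of_int (sign \<sigma>) * (\<Prod>j<m. v (\<phi> (\<sigma> j)) j))"
  by (subst det_col[of _ m]) (auto simp: atLeast0LessThan permutes_in_image intro!: sum.cong prod.cong)

text \<open>
  The Cauchy--Binet formula, summed over all maps \<open>\<phi>\<close> instead of increasing ones: maps that are not injective
  contribute \<open>0\<close>, and each \<open>m\<close>-subset is hit \<open>m!\<close> times. Expanding the first determinant over permutations and
  moving each permutation into \<open>\<phi>\<close> makes the \<open>m!\<close> sums over \<open>\<phi>\<close> equal; each of them is an expanded product of sums.
\<close>

lemma cauchy_binet_functions:
  fixes u v :: "nat \<Rightarrow> nat \<Rightarrow> 'a::comm_ring_1"
  shows "(\<Sum>\<phi>\<in>{..<m} \<rightarrow>\<^sub>E {..<n}.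
      det (mat m m (\<lambda>(i, j). u (\<phi> i) j)) * det (mat m m (\<lambda>(i, j). v (\<phi> i) j))) =
    of_nat (fact m) * det (mat m m (\<lambda>(i, j). \<Sum>k<n. u k i * v k j))"
proof -
  let ?F = "{..<m} \<rightarrow>\<^sub>E {..<n}" and ?S = "{\<pi>. \<pi> permutes {..<m}}"
  let ?V = "\<lambda>\<phi>. det (mat m m (\<lambda>(i, j). v (\<phi> i) j))"
  have "(\<Sum>\<phi>\<in>?F. det (mat m m (\<lambda>(i, j). u (\<phi> i) j)) * ?V \<phi>) =
    (\<Sum>\<phi>\<in>?F. \<Sum>\<pi>\<in>?S. (\<Prod>j<m. u ((\<phi> \<circ> \<pi>) j) j) * ?V (\<phi> \<circ> \<pi>))"
  proof (intro sum.cong refl)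
    fix \<phi>
    have "of_int (sign \<pi>) * (\<Prod>j<m. u (\<phi> (\<pi> j)) j) * ?V \<phi> =
        (\<Prod>j<m. u ((\<phi> \<circ> \<pi>) j) j) * ?V (\<phi> \<circ> \<pi>)" if "\<pi> \<in> ?S" for \<pi>
      using det_permute_arguments[of \<pi> m v \<phi>] that by simp
    then show "det (mat m m (\<lambda>(i, j). u (\<phi> i) j)) * ?V \<phi> =
        (\<Sum>\<pi>\<in>?S. (\<Prod>j<m. u ((\<phi> \<circ> \<pi>) j) j) * ?V (\<phi> \<circ> \<pi>))"
      unfolding det_columns_as_sum[of m u \<phi>] sum_distrib_right by (intro sum.cong refl) blast
  qed
  also have "\<dots> = (\<Sum>\<pi>\<in>?S. \<Sum>\<phi>\<in>?F. (\<Prod>j<m. u ((\<phi> \<circ> \<pi>) j) j) * ?V (\<phi> \<circ> \<pi>))"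
    by (rule sum.swap)
  also have "\<dots> = (\<Sum>\<pi>\<in>?S. \<Sum>\<phi>\<in>?F. (\<Prod>j<m. u (\<phi> j) j) * ?V \<phi>)"
  proof (rule sum.cong[OF refl])
    fix \<pi> assume "\<pi> \<in> ?S"
    then show "(\<Sum>\<phi>\<in>?F. (\<Prod>j<m. u ((\<phi> \<circ> \<pi>) j) j) * ?V (\<phi> \<circ> \<pi>)) =
        (\<Sum>\<phi>\<in>?F. (\<Prod>j<m. u (\<phi> j) j) * ?V \<phi>)"
      by (intro sum_PiE_permute[where h = "\<lambda>\<psi>. (\<Prod>j<m. u (\<psi> j) j) * ?V \<psi>"]) simp
  qed
  also have "\<dots> = of_nat (fact m) * (\<Sum>\<phi>\<in>?F. (\<Prod>j<m. u (\<phi> j) j) * ?V \<phi>)"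
    by (simp add: card_permutations[of "{..<m}" m])
  also have "(\<Sum>\<phi>\<in>?F. (\<Prod>j<m. u (\<phi> j) j) * ?V \<phi>) =
     (\<Sum>\<phi>\<in>?F. \<Sum>\<sigma>\<in>?S. of_int (sign \<sigma>) * (\<Prod>i<m. u (\<phi> i) i * v (\<phi> i) (\<sigma> i)))"
    unfolding det_rows_as_sum sum_distrib_left
    by (intro sum.cong refl) (simp add: prod.distrib mult_ac)
  also have "\<dots> = (\<Sum>\<sigma>\<in>?S. of_int (sign \<sigma>) * (\<Sum>\<phi>\<in>?F. \<Prod>i<m. u (\<phi> i) i * v (\<phi> i) (\<sigma> i)))"
    by (subst sum.swap) (simp add: sum_distrib_left)
  also have "\<dots> = (\<Sum>\<sigma>\<in>?S. of_int (sign \<sigma>) * (\<Prod>i<m. \<Sum>k<n. u k i * v k (\<sigma> i)))"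
    by (simp add: prod_sum_PiE)
  also have "\<dots> = det (mat m m (\<lambda>(i, j). \<Sum>k<n. u k i * v k j))"
    using det_rows_as_sum[of m "\<lambda>i j. \<Sum>k<n. u k i * v k j" "\<lambda>i. i"] by simp
  finally show ?thesis .
qed

section \<open>Christoffel--Darboux kernels over an integral domain\<close>

lemma sum_lessThan_add:
  fixes f :: "nat \<Rightarrow> 'a::comm_monoid_add"
  shows "(\<Sum>k<a + b. f k) = (\<Sum>k<a. f k) + (\<Sum>j<b. f (a + j))"
  by (induction b) (simp_all add: add.assoc)

locale monic_system =
  fixes q :: "nat \<Rightarrow> 'a::idom poly"
  assumes degree_q: "Polynomial.degree (q k) = k"
    and monic_q: "lead_coeff (q k) = 1"
begin

lemma coeff_q: "coeff (q k) k = 1" "i > k \<Longrightarrow> coeff (q k) i = 0"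
  using monic_q[of k] by (auto simp: degree_q coeff_eq_0)

text \<open>
  The degree bound is phrased through vanishing coefficients, so that \<open>N = 0\<close> means \<open>g = 0\<close>.
\<close>

lemma spanned_by_q:
  assumes "\<And>i. i \<ge> N \<Longrightarrow> coeff g i = 0"
  shows "\<exists>c. g = (\<Sum>k<N. Polynomial.smult (c k) (q k))"
  using assms
proof (induction N arbitrary: g)
  case 0
  then show ?case by (simp add: poly_eq_iff)
next
  case (Suc N)
  define g' where "g' = g - Polynomial.smult (coeff g N) (q N)"
  have "coeff g' i = 0" if "i \<ge> N" for i
    using Suc.prems[of i] that by (cases "i = N") (auto simp: g'_def coeff_q)
  from Suc.IH[OF this] obtain c where c: "g' = (\<Sum>k<N. Polynomial.smult (c k) (q k))"
    by blast
  have "g = (\<Sum>k<Suc N. Polynomial.smult ((c(N := coeff g N)) k) (q k))"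
    using c by (simp add: g'_def algebra_simps)
  then show ?case by blast
qed

end

text \<open>
  Orthogonal polynomials over an integral domain. The inverses \<open>w\<^sub>k\<close> of the norms are part of the data, because
  the system has to be carried over from the complex numbers to a ring of polynomials, where division is not available.
\<close>

locale orthogonal_system = monic_system q
  for q :: "nat \<Rightarrow> 'a::idom poly" +
  fixes \<Lambda> :: "'a poly \<Rightarrow> 'a"
    and w :: "nat \<Rightarrow> 'a"
  assumes functional_add: "\<Lambda> (f + g) = \<Lambda> f + \<Lambda> g"
    and functional_smult: "\<Lambda> (Polynomial.smult c f) = c * \<Lambda> f"
    and orthogonal: "j \<noteq> k \<Longrightarrow> \<Lambda> (q j * q k) = 0"
    and inverse_norm: "w k * \<Lambda> (q k * q k) = 1"
begin

lemma functional_sum: "\<Lambda> (\<Sum>k\<in>A. f k) = (\<Sum>k\<in>A. \<Lambda> (f k))"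
proof (induction A rule: infinite_finite_induct)
  case (insert k A)
  then show ?case by (simp add: functional_add)
qed (use functional_smult[of 0 0] in auto)

lemma orthogonal_expansion:
  assumes "\<And>i. i \<ge> N \<Longrightarrow> coeff g i = 0"
  shows "g = (\<Sum>k<N. Polynomial.smult (w k * \<Lambda> (g * q k)) (q k))"
proof -
  obtain c where c: "g = (\<Sum>k<N. Polynomial.smult (c k) (q k))"
    using spanned_by_q[OF assms] by blast
  have "w k * \<Lambda> (g * q k) = c k" if "k < N" for k
  proof -
    have "\<Lambda> (g * q k) = (\<Sum>j<N. c j * \<Lambda> (q j * q k))"
      by (subst c) (simp add: sum_distrib_right functional_sum functional_smult)
    also have "\<dots> = (\<Sum>j<N. if j = k then c k * \<Lambda> (q k * q k) else 0)"
      by (intro sum.cong) (auto simp: orthogonal)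
    also have "\<dots> = c k * \<Lambda> (q k * q k)" using that by simp
    finally show ?thesis using inverse_norm[of k] by (simp add: mult.left_commute)
  qed
  then have "(\<Sum>k<N. Polynomial.smult (c k) (q k)) =
      (\<Sum>k<N. Polynomial.smult (w k * \<Lambda> (g * q k)) (q k))"
    by (intro sum.cong) auto
  with c show ?thesis by (rule trans)
qed

text \<open>
  Only \<open>q\<^sub>N\<close> contributes to the top coefficient in the orthogonal expansion of \<open>g\<close>.
\<close>

lemma functional_times_q:
  assumes "\<And>i. i > N \<Longrightarrow> coeff g i = 0"
  shows "w N * \<Lambda> (g * q N) = coeff g N"
proof -
  have "g = (\<Sum>k<Suc N. Polynomial.smult (w k * \<Lambda> (g * q k)) (q k))"
    by (rule orthogonal_expansion) (use assms in auto)
  then have "coeff g N = coeff (\<Sum>k<Suc N. Polynomial.smult (w k * \<Lambda> (g * q k)) (q k)) N"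
    by (rule arg_cong)
  also have "\<dots> = (\<Sum>k<N. w k * \<Lambda> (g * q k) * coeff (q k) N) + w N * \<Lambda> (g * q N)"
    by (simp add: coeff_sum coeff_q)
  also have "(\<Sum>k<N. w k * \<Lambda> (g * q k) * coeff (q k) N) = 0"
    by (intro sum.neutral) (auto simp: coeff_q)
  finally show ?thesis by simp
qed

definition kernel :: "nat \<Rightarrow> 'a \<Rightarrow> 'a \<Rightarrow> 'a" where
  "kernel n x y = (\<Sum>k<n. w k * poly (q k) x * poly (q k) y)"

definition kernel_poly :: "nat \<Rightarrow> 'a \<Rightarrow> 'a poly" where
  "kernel_poly n x = (\<Sum>k<n. Polynomial.smult (w k * poly (q k) x) (q k))"

lemma poly_kernel_poly: "poly (kernel_poly n x) y = kernel n x y"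
  by (simp add: kernel_poly_def kernel_def poly_sum)

lemma kernel_poly_reproduces:
  assumes "\<And>i. i \<ge> n \<Longrightarrow> coeff g i = 0"
  shows "\<Lambda> (kernel_poly n x * g) = poly g x"
proof -
  have "\<Lambda> (kernel_poly n x * g) = (\<Sum>k<n. w k * \<Lambda> (g * q k) * poly (q k) x)"
    by (simp add: kernel_poly_def sum_distrib_right sum_distrib_left functional_sum
        functional_smult mult_ac)
  also have "\<dots> = poly (\<Sum>k<n. Polynomial.smult (w k * \<Lambda> (g * q k)) (q k)) x"
    by (simp add: poly_sum)
  also have "\<dots> = poly g x" by (simp only: orthogonal_expansion[OF assms, symmetric])
  finally show ?thesis .
qed

text \<open>
  The identity behind the theorem, for arbitrary points of the ring. The block triangular product explained in the
  introduction has determinant \<open>D * det B\<close>; the factor \<open>D\<close> on the other side arises because the coefficients of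
  \<open>q\<^sub>n, \<dots>, q\<^bsub>n+m-1\<^esub>\<close> in \<open>X K(x\<^sub>i, \<cdot>)\<close> form a matrix \<open>S T\<close> with \<open>T\<close> unitriangular and
  \<open>S\<close> equal to \<open>(q\<^bsub>n-m+l\<^esub>(x\<^sub>i))\<close> up to the inverse norms. The common factor \<open>D\<close> is kept, since it can vanish
  for special points.
\<close>

lemma kernel_det_identity:
  fixes x y :: "nat \<Rightarrow> 'a"
  assumes "m \<le> n"
  defines "D \<equiv> det (mat m m (\<lambda>(l, k). poly (q (n - m + l)) (x k)))"
    and "F \<equiv> det (mat (2 * m) (2 * m)
          (\<lambda>(j, k). poly (q (n - m + j)) (if k < m then x k else y (k - m))))"
  shows "(\<Prod>l<m. w (n - m + l)) * D * F =
    D * (\<Prod>k<m. \<Prod>l<m. y k - x l) * det (mat m m (\<lambda>(i, k). kernel n (x i) (y k)))"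
proof -
  define X where "X = (\<Prod>l<m. [:- x l, 1:])"
  have X_zero: "poly X (x k) = 0" if "k < m" for k
    using that by (auto simp: X_def poly_prod intro!: prod_zero)
  have X_val: "poly X t = (\<Prod>l<m. t - x l)" for t
    by (simp add: X_def poly_prod)
  have X_monic: "lead_coeff X = 1" by (simp add: X_def lead_coeff_prod)
  then have X_nz: "X \<noteq> 0" by auto
  have X_deg: "Polynomial.degree X = m"
    by (simp add: X_def degree_prod_eq_sum_degree)
  have q_nz: "q k \<noteq> 0" for k using monic_q[of k] by auto
  have Xq_deg: "Polynomial.degree (X * q k) = m + k" for k
    by (simp add: degree_mult_eq X_nz q_nz X_deg degree_q)
  have Xq_top: "coeff (X * q k) (m + k) = 1" for k
    by (metis Xq_deg X_monic lead_coeff_mult monic_q mult_1)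
  have Xq_zero: "coeff (X * q k) i = 0" if "i > m + k" for i k
    using that by (simp add: Xq_deg coeff_eq_0)
  define G where "G i = X * kernel_poly n (x i)" for i
  define c where "c i j = w (n - m + j) * \<Lambda> (G i * q (n - m + j))" for i j
  have G_zero: "coeff (G i) l = 0" if "l \<ge> (n - m) + 2 * m" for i l
  proof -
    have "coeff (X * q k) l = 0" if "k < n" for k
      using that \<open>l \<ge> _\<close> \<open>m \<le> n\<close> by (intro Xq_zero) auto
    then show ?thesis
      by (simp add: G_def kernel_poly_def sum_distrib_left coeff_sum)
  qed
  \<comment> \<open>Pairing with the kernel evaluates \<open>X q\<^sub>l\<close> at a zero of \<open>X\<close>; this is legitimate as \<open>m + l < n\<close>.\<close>
  have low: "\<Lambda> (G i * q l) = 0" if "l < n - m" "i < m" for i l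
  proof -
    have "\<Lambda> (kernel_poly n (x i) * (X * q l)) = poly (X * q l) (x i)"
      using that by (intro kernel_poly_reproduces Xq_zero) auto
    then show ?thesis using X_zero[OF that(2)] by (simp add: G_def mult_ac)
  qed
  have G_exp: "G i = (\<Sum>j<2 * m. Polynomial.smult (c i j) (q (n - m + j)))" if "i < m" for i
  proof -
    have "G i = (\<Sum>k<(n - m) + 2 * m. Polynomial.smult (w k * \<Lambda> (G i * q k)) (q k))"
      by (rule orthogonal_expansion) (rule G_zero)
    also have "\<dots> = (\<Sum>k<n - m. Polynomial.smult (w k * \<Lambda> (G i * q k)) (q k)) +
        (\<Sum>j<2 * m. Polynomial.smult (c i j) (q (n - m + j)))"
      unfolding c_def by (rule sum_lessThan_add)
    also have "(\<Sum>k<n - m. Polynomial.smult (w k * \<Lambda> (G i * q k)) (q k)) = 0"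
      by (intro sum.neutral) (simp add: low that)
    finally show ?thesis by simp
  qed
  define S where "S = mat m m (\<lambda>(i, l). w (n - m + l) * poly (q (n - m + l)) (x i))"
  define T where "T = mat m m (\<lambda>(l, j). w (n + j) * \<Lambda> (X * q (n - m + l) * q (n + j)))"
  have XqL: "w (n + j) * \<Lambda> (X * q k * q (n + j)) = coeff (X * q k) (n + j)" if "m + k \<le> n + j" for j k
    by (rule functional_times_q) (use that in \<open>auto intro!: Xq_zero\<close>)
  \<comment> \<open>Each summand with \<open>k < n - m\<close> vanishes, because \<open>X q\<^sub>k\<close> has degree below \<open>n\<close>.\<close>
  have c_top: "c i (m + j) = (\<Sum>l<m. S $$ (i, l) * T $$ (l, j))" if "i < m" "j < m" for i j
  proof -
    have "c i (m + j) = (\<Sum>k<n. (w k * poly (q k) (x i)) * (w (n + j) * \<Lambda> (X * q k * q (n + j))))"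
      using \<open>m \<le> n\<close>
      by (simp add: c_def G_def kernel_poly_def sum_distrib_left sum_distrib_right functional_sum
          functional_smult mult_ac)
    also have "n = (n - m) + m" using \<open>m \<le> n\<close> by simp
    also have "(\<Sum>k<n - m + m. (w k * poly (q k) (x i)) * (w ((n - m) + m + j) * \<Lambda> (X * q k * q ((n - m) + m + j)))) =
      (\<Sum>k<n - m. (w k * poly (q k) (x i)) * (w ((n - m) + m + j) * \<Lambda> (X * q k * q ((n - m) + m + j)))) +
      (\<Sum>l<m. (w (n - m + l) * poly (q (n - m + l)) (x i)) * (w ((n - m) + m + j) * \<Lambda> (X * q (n - m + l) * q ((n - m) + m + j))))"
      by (rule sum_lessThan_add)
    also have "(\<Sum>k<n - m. (w k * poly (q k) (x i)) * (w ((n - m) + m + j) * \<Lambda> (X * q k * q ((n - m) + m + j)))) = 0"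
      using \<open>m \<le> n\<close> by (intro sum.neutral) (auto simp: XqL Xq_zero)
    finally show ?thesis using that \<open>m \<le> n\<close> by (simp add: S_def T_def)
  qed
  have T_diag: "T $$ (j, j) = 1" if "j < m" for j
    using that \<open>m \<le> n\<close> XqL[of "n - m + j" j] Xq_top[of "n - m + j"] by (simp add: T_def)
  have T_lower: "T $$ (l, j) = 0" if "l < j" "j < m" for l j
    using that \<open>m \<le> n\<close> XqL[of "n - m + l" j] by (simp add: T_def Xq_zero)
  have T_dim: "T \<in> carrier_mat m m" and S_dim: "S \<in> carrier_mat m m" by (auto simp: T_def S_def)
  have det_T: "det T = 1"
    using det_lower_triangular[OF T_lower T_dim] T_dim
    by (simp add: prod_list_diag_prod T_diag)
  have det_S: "det S = (\<Prod>l<m. w (n - m + l)) * D"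
    unfolding S_def D_def
      det_columns_as_sum[of m "\<lambda>i l. w (n - m + l) * poly (q (n - m + l)) (x i)" "\<lambda>i. i"]
      det_rows_as_sum[of m "\<lambda>l k. poly (q (n - m + l)) (x k)" "\<lambda>l. l"]
    by (simp add: prod.distrib sum_distrib_left mult_ac)
  define C where "C = mat m m (\<lambda>(i, j). c i (m + j))"
  have "C = S * T"
    by (rule eq_matI) (auto simp: C_def c_top S_def T_def scalar_prod_def atLeast0LessThan)
  then have det_C: "det C = (\<Prod>l<m. w (n - m + l)) * D"
    by (simp add: det_mult[OF S_dim T_dim] det_S det_T)
  define P where "P = mat (2 * m) (2 * m)
    (\<lambda>(i, j). if i < m then if i = j then 1 else 0 else c (i - m) j)"
  define Q where "Q = mat (2 * m) (2 * m)
    (\<lambda>(j, k). poly (q (n - m + j)) (if k < m then x k else y (k - m)))"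
  have "P = four_block_mat (1\<^sub>m m) (0\<^sub>m m m) (mat m m (\<lambda>(i, j). c i j)) C"
    by (rule eq_matI) (auto simp: P_def C_def)
  then have det_P: "det P = (\<Prod>l<m. w (n - m + l)) * D"
    using det_four_block_mat_upper_right_zero[of "1\<^sub>m m" m "0\<^sub>m m m" m
        "mat m m (\<lambda>(i, j). c i j)" C] det_C
    by (simp add: C_def)
  define B where "B = mat m m (\<lambda>(i, k). poly X (y k) * kernel n (x i) (y k))"
  have PQ_upper: "(\<Sum>j<2 * m. P $$ (i, j) * Q $$ (j, k)) = Q $$ (i, k)" if "i < m" "k < 2 * m" for i k
  proof -
    have "(\<Sum>j<2 * m. P $$ (i, j) * Q $$ (j, k)) = (\<Sum>j<2 * m. if i = j then Q $$ (j, k) else 0)"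
      using that by (intro sum.cong) (auto simp: P_def)
    then show ?thesis using that by simp
  qed
  have PQ_lower: "(\<Sum>j<2 * m. P $$ (m + i, j) * Q $$ (j, k)) =
      poly X (if k < m then x k else y (k - m)) * kernel n (x i) (if k < m then x k else y (k - m))"
    if "i < m" "k < 2 * m" for i k
  proof -
    define t where "t = (if k < m then x k else y (k - m))"
    have "(\<Sum>j<2 * m. P $$ (m + i, j) * Q $$ (j, k)) = (\<Sum>j<2 * m. c i j * poly (q (n - m + j)) t)"
      using that by (intro sum.cong) (auto simp: P_def Q_def t_def)
    also have "\<dots> = poly (G i) t"
      by (subst G_exp[OF that(1)]) (simp add: poly_sum)
    finally show ?thesis by (simp add: G_def poly_kernel_poly t_def)
  qed
  have PQ: "P * Q = four_block_mat (mat m m (\<lambda>(l, k). poly (q (n - m + l)) (x k)))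
      (mat m m (\<lambda>(l, k). poly (q (n - m + l)) (y k))) (0\<^sub>m m m) B" (is "_ = ?R")
  proof (rule eq_matI)
    fix i k assume "i < dim_row ?R" "k < dim_col ?R"
    then have ik: "i < 2 * m" "k < 2 * m" by (auto simp: B_def)
    then have "(P * Q) $$ (i, k) = (\<Sum>j<2 * m. P $$ (i, j) * Q $$ (j, k))"
      by (simp add: P_def Q_def scalar_prod_def atLeast0LessThan)
    also have "\<dots> = ?R $$ (i, k)"
    proof (cases "i < m")
      case True
      then show ?thesis using ik PQ_upper[of i k] by (auto simp: Q_def B_def)
    next
      case False
      then show ?thesis using ik PQ_lower[of "i - m" k] by (auto simp: B_def X_zero)
    qed
    finally show "(P * Q) $$ (i, k) = ?R $$ (i, k)" .
  qed (auto simp: P_def Q_def B_def)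
  have "det (P * Q) = D * det B"
    unfolding PQ D_def by (rule det_four_block_mat_lower_left_zero[of _ m _ m]) (auto simp: B_def)
  moreover have "det (P * Q) = det P * F"
    unfolding F_def Q_def[symmetric] by (rule det_mult[of _ "2 * m"]) (auto simp: P_def Q_def)
  moreover have "det B = (\<Prod>k<m. poly X (y k)) * det (mat m m (\<lambda>(i, k). kernel n (x i) (y k)))"
    unfolding B_def
      det_columns_as_sum[of m "\<lambda>i k. poly X (y k) * kernel n (x i) (y k)" "\<lambda>i. i"]
      det_columns_as_sum[of m "\<lambda>i k. kernel n (x i) (y k)" "\<lambda>i. i"]
    by (simp add: prod.distrib sum_distrib_left mult_ac)
  ultimately show ?thesis by (simp add: det_P X_val mult_ac)
qed

end

section \<open>Substitution and univariate polynomials in a chosen variable\<close>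

lemma Const_eq_0: "Const x = 0 \<Longrightarrow> x = 0"
  by (metis Const_def lookup_single_eq lookup_zero)

interpretation Const_hom: inj_idom_hom Const
  by unfold_locales (auto simp: Const_def single_add mult_single dest: Const_eq_0[unfolded Const_def])

interpretation map_poly_Const: map_poly_inj_idom_hom Const ..

lemma sum_monomials:
  fixes f :: "'a \<Rightarrow>\<^sub>0 'b::comm_monoid_add"
  shows "(\<Sum>a\<in>Poly_Mapping.keys f. Poly_Mapping.single a (Poly_Mapping.lookup f a)) = f"
  by (rule poly_mapping_eqI)
    (auto simp: lookup_sum lookup_single when_def in_keys_iff)

lemma single_as_Const_mult: "Poly_Mapping.single a c = Const c * Poly_Mapping.single a 1"
  by (simp add: Const_def mult_single)

lemma Var_power: "Var i ^ k = Poly_Mapping.single (Poly_Mapping.single i k) 1"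
  by (induction k) (simp_all add: Var_def mult_single single_add[symmetric])

lemma prod_single:
  fixes c :: "'i \<Rightarrow> complex" and a :: "'i \<Rightarrow> (nat \<Rightarrow>\<^sub>0 nat)"
  shows "(\<Prod>i\<in>A. Poly_Mapping.single (a i) (c i)) = Poly_Mapping.single (\<Sum>i\<in>A. a i) (\<Prod>i\<in>A. c i)"
  by (induction A rule: infinite_finite_induct) (simp_all add: mult_single)

lemma cmpoly_induct [case_names monomial add]:
  fixes f :: cmpoly
  assumes "\<And>a c. P (Poly_Mapping.single a c)" and "\<And>f g. P f \<Longrightarrow> P g \<Longrightarrow> P (f + g)"
  shows "P f"
proof -
  have "P (\<Sum>a\<in>A. Poly_Mapping.single a (Poly_Mapping.lookup f a))" for A
  proof (induction A rule: infinite_finite_induct)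
    case empty
    show ?case using assms(1)[of 0 0] by simp
  next
    case (infinite A)
    then show ?case using assms(1)[of 0 0] by simp
  qed (simp add: assms)
  from this[of "Poly_Mapping.keys f"] show ?thesis by (simp add: sum_monomials)
qed

text \<open>
  The operations on polynomials are sums over the support of the argument, and the support of a sum can be smaller
  than the union. Terms with coefficient \<open>0\<close> vanish, so all sums may run over the union.
\<close>

lemma sum_keys_add:
  fixes f g :: cmpoly and h :: "(nat \<Rightarrow>\<^sub>0 nat) \<Rightarrow> complex \<Rightarrow> 'b::comm_monoid_add"
  assumes zero: "\<And>a. h a 0 = 0" and add: "\<And>a c d. h a (c + d) = h a c + h a d"
  shows "(\<Sum>a\<in>Poly_Mapping.keys (f + g). h a (Poly_Mapping.lookup (f + g) a)) =
    (\<Sum>a\<in>Poly_Mapping.keys f. h a (Poly_Mapping.lookup f a)) +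
    (\<Sum>a\<in>Poly_Mapping.keys g. h a (Poly_Mapping.lookup g a))"
proof -
  let ?A = "Poly_Mapping.keys f \<union> Poly_Mapping.keys g"
  have ext: "(\<Sum>a\<in>Poly_Mapping.keys k. h a (Poly_Mapping.lookup k a)) =
      (\<Sum>a\<in>?A. h a (Poly_Mapping.lookup k a))" if "Poly_Mapping.keys k \<subseteq> ?A" for k :: cmpoly
    using that by (intro sum.mono_neutral_left) (auto simp: in_keys_iff zero)
  show ?thesis
    using ext[of f] ext[of g] ext[of "f + g"] keys_add[of f g]
    by (simp add: lookup_add add sum.distrib)
qed

definition subst_monomial :: "(nat \<Rightarrow> cmpoly) \<Rightarrow> (nat \<Rightarrow>\<^sub>0 nat) \<Rightarrow> cmpoly" where
  "subst_monomial \<sigma> a = (\<Prod>i\<in>Poly_Mapping.keys a. \<sigma> i ^ Poly_Mapping.lookup a i)"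

lemma subst_monomial_superset:
  assumes "finite A" "Poly_Mapping.keys a \<subseteq> A"
  shows "subst_monomial \<sigma> a = (\<Prod>i\<in>A. \<sigma> i ^ Poly_Mapping.lookup a i)"
  unfolding subst_monomial_def using assms
  by (intro prod.mono_neutral_left) (auto simp: in_keys_iff)

lemma subst_monomial_add: "subst_monomial \<sigma> (a + b) = subst_monomial \<sigma> a * subst_monomial \<sigma> b"
proof -
  let ?A = "Poly_Mapping.keys a \<union> Poly_Mapping.keys b"
  have "Poly_Mapping.keys (a + b) \<subseteq> ?A" by (rule keys_add)
  then show ?thesis
    by (simp add: subst_monomial_superset[of ?A] lookup_add power_add prod.distrib)
qed

lemma subst_add: "subst \<sigma> (f + g) = subst \<sigma> f + subst \<sigma> g"
  unfolding subst_def
  using sum_keys_add[of "\<lambda>a c. Const c * (\<Prod>i\<in>Poly_Mapping.keys a. \<sigma> i ^ Poly_Mapping.lookup a i)" f g]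
  by (simp add: Const_hom.hom_add distrib_right)

lemma subst_single: "subst \<sigma> (Poly_Mapping.single a c) = Const c * subst_monomial \<sigma> a"
  by (simp add: subst_def subst_monomial_def)

lemma subst_mult: "subst \<sigma> (f * g) = subst \<sigma> f * subst \<sigma> g"
proof (induction f rule: cmpoly_induct)
  case (monomial a c)
  show ?case
  proof (induction g rule: cmpoly_induct)
    case (monomial b d)
    show ?case
      by (simp add: mult_single subst_single subst_monomial_add Const_hom.hom_mult mult_ac)
  qed (simp only: distrib_left subst_add)
qed (simp add: distrib_right subst_add)

lemma subst_Const [simp]: "subst \<sigma> (Const c) = Const c"
  by (simp add: Const_def[of c] subst_single subst_monomial_def)

lemma subst_Var [simp]: "subst \<sigma> (Var i) = \<sigma> i"
  by (simp add: Var_def subst_single subst_monomial_def)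

interpretation subst_hom: idom_hom "subst \<sigma>" for \<sigma>
proof
  show "subst \<sigma> 0 = 0" using subst_Const[of \<sigma> 0] by simp
  show "subst \<sigma> 1 = 1" using subst_Const[of \<sigma> 1] by simp
qed (simp_all add: subst_add subst_mult)

lemma poly_at_pCons: "poly_at (pCons a f) i = Const a + Var i * poly_at f i"
  by (simp add: poly_at_def Const_hom.map_poly_pCons_hom)

lemma poly_at_0 [simp]: "poly_at 0 i = 0" by (simp add: poly_at_def)
lemma poly_at_add: "poly_at (f + g) i = poly_at f i + poly_at g i"
  by (simp add: poly_at_def map_poly_Const.hom_add)
lemma poly_at_mult: "poly_at (f * g) i = poly_at f i * poly_at g i"
  by (simp add: poly_at_def map_poly_Const.hom_mult)
lemma poly_at_smult: "poly_at (Polynomial.smult c f) i = Const c * poly_at f i"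
  by (simp add: poly_at_def Const_hom.map_poly_hom_smult)
lemma poly_at_sum: "poly_at (\<Sum>k\<in>A. f k) i = (\<Sum>k\<in>A. poly_at (f k) i)"
  by (simp add: poly_at_def map_poly_Const.hom_sum poly_sum)
lemma poly_at_monom: "poly_at (Polynomial.monom 1 k) i = Var i ^ k"
  by (simp add: poly_at_def poly_monom)

lemma subst_poly_at: "\<sigma> i = Var j \<Longrightarrow> subst \<sigma> (poly_at f i) = poly_at f j"
  by (induction f) (simp_all add: poly_at_pCons subst_add subst_mult)

definition exponent :: "nat \<Rightarrow> (nat \<Rightarrow> nat) \<Rightarrow> (nat \<Rightarrow>\<^sub>0 nat)" where
  "exponent m \<kappa> = (\<Sum>i<m. Poly_Mapping.single i (\<kappa> i))"

lemma lookup_exponent: "Poly_Mapping.lookup (exponent m \<kappa>) i = (if i < m then \<kappa> i else 0)"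
  by (auto simp: exponent_def lookup_sum lookup_single when_def)

lemma poly_at_as_sum:
  assumes "Polynomial.degree f < N"
  shows "poly_at f i = (\<Sum>k<N. Poly_Mapping.single (Poly_Mapping.single i k) (coeff f k))"
proof -
  have "f = (\<Sum>k<N. Polynomial.smult (coeff f k) (Polynomial.monom 1 k))"
    using assms by (intro poly_eqI) (auto simp: coeff_sum coeff_eq_0 if_distrib[of "\<lambda>x. _ * x"] cong: if_cong)
  then have "poly_at f i = poly_at (\<Sum>k<N. Polynomial.smult (coeff f k) (Polynomial.monom 1 k)) i"
    by (rule arg_cong)
  also have "\<dots> = (\<Sum>k<N. Poly_Mapping.single (Poly_Mapping.single i k) (coeff f k))"
    unfolding poly_at_sum poly_at_smult poly_at_monom Var_power
    by (intro sum.cong refl) (rule single_as_Const_mult[symmetric])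
  finally show ?thesis .
qed

lemma prod_poly_at_as_sum:
  assumes "\<And>i. i < m \<Longrightarrow> Polynomial.degree (f i) < N"
  shows "(\<Prod>i<m. poly_at (f i) i) =
    (\<Sum>\<kappa>\<in>{..<m} \<rightarrow>\<^sub>E {..<N}. Poly_Mapping.single (exponent m \<kappa>) (\<Prod>i<m. coeff (f i) (\<kappa> i)))"
proof -
  have "(\<Prod>i<m. poly_at (f i) i) =
      (\<Prod>i<m. \<Sum>k<N. Poly_Mapping.single (Poly_Mapping.single i k) (coeff (f i) k))"
    using assms by (intro prod.cong) (auto simp: poly_at_as_sum)
  also have "\<dots> = (\<Sum>\<kappa>\<in>{..<m} \<rightarrow>\<^sub>E {..<N}. \<Prod>i<m. Poly_Mapping.single (Poly_Mapping.single i (\<kappa> i)) (coeff (f i) (\<kappa> i)))"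
    by (rule prod_sum_PiE) auto
  finally show ?thesis by (simp add: prod_single exponent_def)
qed

text \<open>
  The bound is \<open>n - 1\<close> in truncated subtraction, to agree with \<open>antisym_space\<close> at \<open>n = 0\<close>.
\<close>

definition degree_box :: "nat \<Rightarrow> nat \<Rightarrow> cmpoly set" where
  "degree_box n m = {f. \<forall>a\<in>Poly_Mapping.keys f.
     Poly_Mapping.keys a \<subseteq> {..<m} \<and> (\<forall>i<m. Poly_Mapping.lookup a i \<le> n - 1)}"

lemma degree_box_single:
  assumes "Poly_Mapping.keys a \<subseteq> {..<m}" "\<And>i. i < m \<Longrightarrow> Poly_Mapping.lookup a i \<le> n - 1"
  shows "Poly_Mapping.single a c \<in> degree_box n m"
  using assms by (auto simp: degree_box_def)

lemma degree_box_sum: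
  assumes "\<And>k. k \<in> A \<Longrightarrow> f k \<in> degree_box n m"
  shows "(\<Sum>k\<in>A. f k) \<in> degree_box n m"
  using assms
proof (induction A rule: infinite_finite_induct)
  case (insert k A)
  then have "f k \<in> degree_box n m" "sum f A \<in> degree_box n m" by auto
  then show ?case
    using insert.hyps keys_add[of "f k" "sum f A"] unfolding degree_box_def by fastforce
qed (auto simp: degree_box_def)

lemma degree_box_Const_mult:
  assumes "f \<in> degree_box n m"
  shows "Const c * f \<in> degree_box n m"
proof -
  have "Poly_Mapping.keys (Const c * f) \<subseteq> Poly_Mapping.keys f"
    using keys_mult[of "Const c" f] by (auto simp: Const_def split: if_splits)
  then show ?thesis using assms unfolding degree_box_def by blast
qed

lemma degree_box_prod_poly_at:
  assumes "\<And>i. i < m \<Longrightarrow> Polynomial.degree (f i) < n"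
  shows "(\<Prod>i<m. poly_at (f i) i) \<in> degree_box n m"
proof -
  have "Poly_Mapping.single (exponent m \<kappa>) c \<in> degree_box n m"
    if "\<kappa> \<in> {..<m} \<rightarrow>\<^sub>E {..<n}" for \<kappa> c
  proof (rule degree_box_single)
    show "Poly_Mapping.keys (exponent m \<kappa>) \<subseteq> {..<m}"
      by (auto simp: in_keys_iff lookup_exponent split: if_splits)
    show "Poly_Mapping.lookup (exponent m \<kappa>) i \<le> n - 1" if "i < m" for i
    proof -
      have "\<kappa> i < n" using PiE_mem[OF \<open>\<kappa> \<in> _\<close>, of i] that by simp
      then show ?thesis using that by (simp add: lookup_exponent)
    qed
  qed
  moreover have "(\<Prod>i<m. poly_at (f i) i) =
      (\<Sum>\<kappa>\<in>{..<m} \<rightarrow>\<^sub>E {..<n}. Poly_Mapping.single (exponent m \<kappa>) (\<Prod>i<m. coeff (f i) (\<kappa> i)))"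
    using assms by (rule prod_poly_at_as_sum)
  ultimately show ?thesis by (simp add: degree_box_sum)
qed

lemma monomial_as_prod_poly_at:
  assumes "Poly_Mapping.keys a \<subseteq> {..<m}"
  shows "Poly_Mapping.single a c =
    Const c * (\<Prod>i<m. poly_at (Polynomial.monom 1 (Poly_Mapping.lookup a i)) i)"
proof -
  have "exponent m (Poly_Mapping.lookup a) = a"
    using assms by (intro poly_mapping_eqI) (auto simp: lookup_exponent in_keys_iff subset_eq)
  then show ?thesis
    by (simp add: poly_at_monom Var_power prod_single exponent_def single_as_Const_mult[of a c])
qed

section \<open>Integration in several variables\<close>

lemma apply_var_add: "apply_var L i (f + g) = apply_var L i f + apply_var L i g"
  unfolding apply_var_def
  by (rule sum_keys_add[of "\<lambda>a c. Poly_Mapping.single (Poly_Mapping.update i 0 a)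
       (c * L (Polynomial.monom 1 (Poly_Mapping.lookup a i)))"])
    (simp_all add: distrib_right single_add)

lemma apply_var_single:
  "apply_var L i (Poly_Mapping.single a c) = Poly_Mapping.single (Poly_Mapping.update i 0 a)
     (c * L (Polynomial.monom 1 (Poly_Mapping.lookup a i)))"
  by (simp add: apply_var_def)

lemma fold_apply_var_add:
  "fold (apply_var L) xs (f + g) = fold (apply_var L) xs f + fold (apply_var L) xs g"
  by (induction xs arbitrary: f g) (simp_all add: apply_var_add)

lemma fold_apply_var_single:
  assumes "distinct xs"
  shows "fold (apply_var L) xs (Poly_Mapping.single a c) =
    Poly_Mapping.single (fold (\<lambda>i. Poly_Mapping.update i 0) xs a)
      (c * (\<Prod>i\<in>set xs. L (Polynomial.monom 1 (Poly_Mapping.lookup a i))))"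
  using assms
proof (induction xs arbitrary: a c)
  case (Cons i xs)
  have "(\<Prod>j\<in>set xs. L (Polynomial.monom 1 (Poly_Mapping.lookup (Poly_Mapping.update i 0 a) j))) =
    (\<Prod>j\<in>set xs. L (Polynomial.monom 1 (Poly_Mapping.lookup a j)))"
    using Cons.prems by (intro prod.cong) (auto simp: lookup_update)
  then show ?case using Cons by (simp add: apply_var_single mult_ac)
qed simp

lemma lookup_fold_update_zero:
  "Poly_Mapping.lookup (fold (\<lambda>i. Poly_Mapping.update i 0) xs a) j =
    (if j \<in> set xs then 0 else Poly_Mapping.lookup a j)"
  by (induction xs arbitrary: a) (auto simp: lookup_update)

definition polynomials_in :: "nat \<Rightarrow> cmpoly set" where
  "polynomials_in m = {f. \<forall>a\<in>Poly_Mapping.keys f. Poly_Mapping.keys a \<subseteq> {..<m}}"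

lemma multi_functional_add:
  "multi_functional L s m (f + g) = multi_functional L s m f + multi_functional L s m g"
  by (simp add: multi_functional_def fold_apply_var_add distrib_left)

lemma multi_functional_0 [simp]: "multi_functional L s m 0 = 0"
  using multi_functional_add[of L s m 0 0] by simp

lemma multi_functional_sum: "multi_functional L s m (\<Sum>k\<in>A. f k) = (\<Sum>k\<in>A. multi_functional L s m (f k))"
  by (induction A rule: infinite_finite_induct) (simp_all add: multi_functional_add)

text \<open>
  A number rather than a constant polynomial, and without the factor \<open>1 / m!\<close> of \<open>multi_functional\<close>.
\<close>

definition integral_all :: "(complex poly \<Rightarrow> complex) \<Rightarrow> nat \<Rightarrow> cmpoly \<Rightarrow> complex" where
  "integral_all L m f = (\<Sum>a\<in>Poly_Mapping.keys f. Poly_Mapping.lookup f a *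
     (\<Prod>i<m. L (Polynomial.monom 1 (Poly_Mapping.lookup a i))))"

lemma integral_all_add: "integral_all L m (f + g) = integral_all L m f + integral_all L m g"
  unfolding integral_all_def
  by (rule sum_keys_add[of "\<lambda>a c. c * (\<Prod>i<m. L (Polynomial.monom 1 (Poly_Mapping.lookup a i)))"])
    (simp_all add: distrib_right)

lemma integral_all_single:
  "integral_all L m (Poly_Mapping.single a c) =
    c * (\<Prod>i<m. L (Polynomial.monom 1 (Poly_Mapping.lookup a i)))"
  by (simp add: integral_all_def)

lemma integral_all_Const_mult: "integral_all L m (Const c * f) = c * integral_all L m f"
  by (induction f rule: cmpoly_induct)
    (simp_all add: Const_def mult_single integral_all_single distrib_left integral_all_add mult.assoc)

lemma integral_all_0 [simp]: "integral_all L m 0 = 0"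
  by (simp add: integral_all_def)

lemma integral_all_sum: "integral_all L m (\<Sum>k\<in>A. f k) = (\<Sum>k\<in>A. integral_all L m (f k))"
  by (induction A rule: infinite_finite_induct) (simp_all add: integral_all_add)

lemma subst_rename_single:
  assumes "finite A" "Poly_Mapping.keys a \<subseteq> A"
  shows "subst (\<lambda>i. Var (\<rho> i)) (Poly_Mapping.single a c) =
    Poly_Mapping.single (\<Sum>i\<in>A. Poly_Mapping.single (\<rho> i) (Poly_Mapping.lookup a i)) c"
  by (simp add: subst_single subst_monomial_superset[OF assms] Var_power prod_single
      single_as_Const_mult[symmetric])

text \<open>
  All variables are integrated with the same functional, so their order is irrelevant.
\<close>

lemma integral_all_permute:
  assumes p: "\<pi> permutes {..<m}"
  shows "integral_all L m (subst (\<lambda>i. Var (\<pi> i)) f) = integral_all L m f"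
proof (induction f rule: cmpoly_induct)
  case (monomial a c)
  define A where "A = Poly_Mapping.keys a \<union> {..<m}"
  define b where "b = (\<Sum>i\<in>A. Poly_Mapping.single (\<pi> i) (Poly_Mapping.lookup a i))"
  have look: "Poly_Mapping.lookup b (\<pi> i) = Poly_Mapping.lookup a i" if "i < m" for i
  proof -
    have "Poly_Mapping.lookup b (\<pi> i) = (\<Sum>j\<in>A. if j = i then Poly_Mapping.lookup a j else 0)"
      unfolding b_def lookup_sum lookup_single when_def
      by (intro sum.cong) (use permutes_inj[OF p] in \<open>auto dest: injD\<close>)
    then show ?thesis using that by (simp add: A_def)
  qed
  have "(\<Prod>i<m. L (Polynomial.monom 1 (Poly_Mapping.lookup b i))) =
      (\<Prod>i<m. L (Polynomial.monom 1 (Poly_Mapping.lookup b (\<pi> i))))"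
    by (rule prod.permute[OF p, unfolded comp_def])
  also have "\<dots> = (\<Prod>i<m. L (Polynomial.monom 1 (Poly_Mapping.lookup a i)))"
    by (intro prod.cong) (auto simp: look)
  finally show ?case
    by (subst subst_rename_single[of A]) (auto simp: A_def b_def integral_all_single)
qed (simp add: subst_add integral_all_add)

text \<open>
  Fubini for a product of separated variables: applied to the variables \<open>m, \<dots>, 2 m - 1\<close>, the
  functional sees only the factor \<open>h(y)\<close>, and \<open>g(x)\<close> is a constant for it. By bilinearity both factors may
  be taken to be monomials, for which the exponents of \<open>y\<close> are erased one after the other.
\<close>

lemma multi_functional_split:
  assumes "g \<in> polynomials_in m" "h \<in> polynomials_in m"
  shows "multi_functional L m m (g * shift_vars m h) = g * Const (integral_all L m h / fact m)"
proof -
  have single: "fold (apply_var L) [m..<m + m] (Poly_Mapping.single a c * shift_vars m (Poly_Mapping.single b d)) =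
      Poly_Mapping.single a c * Const (integral_all L m (Poly_Mapping.single b d))"
    if a: "Poly_Mapping.keys a \<subseteq> {..<m}" and b: "Poly_Mapping.keys b \<subseteq> {..<m}" for a b c d
  proof -
    define b' where "b' = (\<Sum>i<m. Poly_Mapping.single (m + i) (Poly_Mapping.lookup b i))"
    have b'_high: "Poly_Mapping.lookup b' (i + m) = Poly_Mapping.lookup b i" if "i < m" for i
    proof -
      have "Poly_Mapping.lookup b' (i + m) = (\<Sum>j<m. if j = i then Poly_Mapping.lookup b j else 0)"
        unfolding b'_def lookup_sum lookup_single when_def by (intro sum.cong) auto
      then show ?thesis using that by simp
    qed
    have b'_low: "Poly_Mapping.lookup b' i = 0" if "i < m \<or> i \<ge> m + m" for i
      unfolding b'_def lookup_sum lookup_single when_def using that by (intro sum.neutral) auto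
    have a_high: "Poly_Mapping.lookup a i = 0" if "i \<ge> m" for i
      using a that by (meson in_keys_iff lessThan_iff not_le subsetD)
    have exps: "fold (\<lambda>i. Poly_Mapping.update i 0) [m..<m + m] (a + b') = a"
      by (rule poly_mapping_eqI)
        (auto simp: lookup_fold_update_zero lookup_add b'_low a_high)
    have "(\<Prod>i\<in>{m..<m + m}. L (Polynomial.monom 1 (Poly_Mapping.lookup (a + b') i))) =
        (\<Prod>i<m. L (Polynomial.monom 1 (Poly_Mapping.lookup b i)))"
      using prod.shift_bounds_nat_ivl[of "\<lambda>i. L (Polynomial.monom 1 (Poly_Mapping.lookup (a + b') i))" 0 m m]
      by (simp add: lookup_add a_high b'_high atLeast0LessThan)
    then have "fold (apply_var L) [m..<m + m] (Poly_Mapping.single (a + b') (c * d)) =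
        Poly_Mapping.single a (c * d * (\<Prod>i<m. L (Polynomial.monom 1 (Poly_Mapping.lookup b i))))"
      by (subst fold_apply_var_single) (simp_all add: exps)
    moreover have "shift_vars m (Poly_Mapping.single b d) = Poly_Mapping.single b' d"
      unfolding shift_vars_def b'_def by (rule subst_rename_single) (use b in auto)
    ultimately show ?thesis
      by (simp add: mult_single Const_def integral_all_single mult.assoc)
  qed
  have fold_sum: "fold (apply_var L) xs (\<Sum>k\<in>A. f k) = (\<Sum>k\<in>A. fold (apply_var L) xs (f k))"
    if "finite A" for xs f and A :: "(nat \<Rightarrow>\<^sub>0 nat) set"
    using that fold_apply_var_add[of L xs 0 0]
    by (induction A rule: finite_induct) (simp_all add: fold_apply_var_add)
  let ?g = "\<lambda>a. Poly_Mapping.single a (Poly_Mapping.lookup g a)"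
  let ?h = "\<lambda>b. Poly_Mapping.single b (Poly_Mapping.lookup h b)"
  have "g * shift_vars m h =
      (\<Sum>a\<in>Poly_Mapping.keys g. ?g a) * shift_vars m (\<Sum>b\<in>Poly_Mapping.keys h. ?h b)"
    by (simp add: sum_monomials)
  also have "\<dots> = (\<Sum>a\<in>Poly_Mapping.keys g. \<Sum>b\<in>Poly_Mapping.keys h. ?g a * shift_vars m (?h b))"
    unfolding shift_vars_def subst_hom.hom_sum sum_product ..
  finally have "fold (apply_var L) [m..<m + m] (g * shift_vars m h) =
      (\<Sum>a\<in>Poly_Mapping.keys g. \<Sum>b\<in>Poly_Mapping.keys h.
        fold (apply_var L) [m..<m + m] (?g a * shift_vars m (?h b)))"
    by (simp add: fold_sum)
  also have "\<dots> = (\<Sum>a\<in>Poly_Mapping.keys g. \<Sum>b\<in>Poly_Mapping.keys h.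
        ?g a * Const (integral_all L m (?h b)))"
    by (intro sum.cong refl single) (use assms in \<open>auto simp: polynomials_in_def\<close>)
  also have "\<dots> = (\<Sum>a\<in>Poly_Mapping.keys g. ?g a) *
      Const (integral_all L m (\<Sum>b\<in>Poly_Mapping.keys h. ?h b))"
    unfolding sum_product integral_all_sum Const_hom.hom_sum ..
  also have "\<dots> = g * Const (integral_all L m h)"
    by (simp only: sum_monomials)
  finally show ?thesis
    by (simp add: multi_functional_def Const_hom.hom_mult[symmetric] mult.left_commute)
qed

section \<open>Expansion of antisymmetric polynomials in alternants\<close>

definition product_basis :: "(nat \<Rightarrow> complex poly) \<Rightarrow> nat \<Rightarrow> (nat \<Rightarrow> nat) \<Rightarrow> cmpoly" where
  "product_basis p m \<phi> = (\<Prod>i<m. poly_at (p (\<phi> i)) i)"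

text \<open>
  An alternant of orthogonal polynomials, also known as a Slater determinant.
\<close>

definition slater :: "(nat \<Rightarrow> complex poly) \<Rightarrow> nat \<Rightarrow> (nat \<Rightarrow> nat) \<Rightarrow> cmpoly" where
  "slater p m \<phi> = det (mat m m (\<lambda>(i, j). poly_at (p (\<phi> i)) j))"

lemma slater_as_sum:
  "slater p m \<phi> = (\<Sum>\<sigma> | \<sigma> permutes {..<m}. Const (of_int (sign \<sigma>)) * product_basis p m (\<phi> \<circ> \<sigma>))"
  unfolding slater_def product_basis_def Const_hom.hom_of_int comp_def
  by (rule det_columns_as_sum)

lemma subst_product_basis:
  assumes "\<pi> permutes {..<m}"
  shows "subst (\<lambda>i. Var (\<pi> i)) (product_basis p m (\<phi> \<circ> \<pi>)) = product_basis p m \<phi>"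
proof -
  have "subst (\<lambda>i. Var (\<pi> i)) (product_basis p m (\<phi> \<circ> \<pi>)) =
      (\<Prod>i<m. poly_at (p (\<phi> (\<pi> i))) (\<pi> i))"
    by (simp add: product_basis_def subst_hom.hom_prod subst_poly_at)
  also have "\<dots> = product_basis p m \<phi>"
    using prod.permute[OF assms, of "\<lambda>i. poly_at (p (\<phi> i)) i"]
    by (simp add: product_basis_def comp_def)
  finally show ?thesis .
qed

lemma slater_permute:
  assumes "\<pi> permutes {..<m}"
  shows "slater p m (\<phi> \<circ> \<pi>) = of_int (sign \<pi>) * slater p m \<phi>"
  unfolding slater_def comp_def by (rule det_permute_arguments[OF assms, of "\<lambda>k. poly_at (p k)"])

text \<open>
  Renaming the points permutes the columns. The statement is reduced to a permutation of rows by transposing.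
\<close>

lemma subst_slater:
  assumes p: "\<pi> permutes {..<m}"
  shows "subst (\<lambda>i. Var (\<pi> i)) (slater p m \<phi>) = of_int (sign \<pi>) * slater p m \<phi>"
proof -
  have "slater p m \<phi> = of_int (sign \<pi>) * slater p m (\<phi> \<circ> \<pi>)"
    by (simp add: slater_permute[OF p] mult.assoc[symmetric] of_int_mult[symmetric]
        sign_idempotent del: of_int_mult)
  then have "subst (\<lambda>i. Var (\<pi> i)) (slater p m \<phi>) =
      of_int (sign \<pi>) * subst (\<lambda>i. Var (\<pi> i)) (slater p m (\<phi> \<circ> \<pi>))"
    by (metis subst_hom.hom_mult subst_hom.hom_of_int)
  also have "subst (\<lambda>i. Var (\<pi> i)) (slater p m (\<phi> \<circ> \<pi>)) =
      det (mat m m (\<lambda>(i, j). poly_at (p (\<phi> (\<pi> i))) (\<pi> j)))"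
    unfolding slater_def
    by (subst subst_hom.hom_det[symmetric], intro arg_cong[of _ _ det] eq_matI)
      (auto simp: subst_poly_at)
  also have "\<dots> = slater p m \<phi>"
  proof -
    have "det (mat m m (\<lambda>(i, j). poly_at (p (\<phi> (\<pi> i))) (\<pi> j))) =
       of_int (sign \<pi>) * det (mat m m (\<lambda>(i, j). poly_at (p (\<phi> i)) (\<pi> j)))"
      by (rule det_permute_arguments[OF p, of "\<lambda>k j. poly_at (p k) (\<pi> j)"])
    also have "det (mat m m (\<lambda>(i, j). poly_at (p (\<phi> i)) (\<pi> j))) =
        det (mat m m (\<lambda>(j, i). poly_at (p (\<phi> i)) (\<pi> j)))"
      by (subst det_transpose[symmetric, of _ m]) (auto intro!: arg_cong[of _ _ det] eq_matI)
    also have "\<dots> = of_int (sign \<pi>) * det (mat m m (\<lambda>(j, i). poly_at (p (\<phi> i)) j))"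
      by (rule det_permute_arguments[OF p, of "\<lambda>j i. poly_at (p (\<phi> i)) j" "\<lambda>j. j"])
    also have "det (mat m m (\<lambda>(j, i). poly_at (p (\<phi> i)) j)) = slater p m \<phi>"
      unfolding slater_def
      by (subst det_transpose[symmetric, of _ m]) (auto intro!: arg_cong[of _ _ det] eq_matI)
    finally show ?thesis
      by (simp add: mult.assoc[symmetric] of_int_mult[symmetric] sign_idempotent del: of_int_mult)
  qed
  finally show ?thesis .
qed

lemma antisym_space_iff:
  "f \<in> antisym_space n m \<longleftrightarrow> f \<in> degree_box n m \<and>
    (\<forall>\<pi>. \<pi> permutes {..<m} \<longrightarrow> subst (\<lambda>i. Var (\<pi> i)) f = of_int (sign \<pi>) * f)"
  by (auto simp: antisym_space_def degree_box_def)

lemma antisym_space_Const_mult: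
  "f \<in> antisym_space n m \<Longrightarrow> Const c * f \<in> antisym_space n m"
  by (auto simp: antisym_space_iff degree_box_Const_mult subst_mult mult.left_commute)

lemma degree_box_subset_polynomials_in: "degree_box n m \<subseteq> polynomials_in m"
  by (auto simp: degree_box_def polynomials_in_def)

lemma polynomials_in_mult:
  assumes "f \<in> polynomials_in m" "g \<in> polynomials_in m"
  shows "f * g \<in> polynomials_in m"
proof -
  have "Poly_Mapping.keys c \<subseteq> {..<m}" if c: "c \<in> Poly_Mapping.keys (f * g)" for c
  proof -
    obtain a b where "c = a + b" "a \<in> Poly_Mapping.keys f" "b \<in> Poly_Mapping.keys g"
      using keys_mult[of f g] c by blast
    then show ?thesis
      using assms keys_add[of a b] unfolding polynomials_in_def by blast
  qed
  then show ?thesis by (simp add: polynomials_in_def)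
qed

lemma sum_Const_mult: "Const (\<Sum>k\<in>A. c k) * f = (\<Sum>k\<in>A. Const (c k) * f)"
  by (simp add: Const_hom.hom_sum sum_distrib_right)

locale complex_orthogonal_system = orthogonal_system p L w
  for p :: "nat \<Rightarrow> complex poly" and L :: "complex poly \<Rightarrow> complex" and w :: "nat \<Rightarrow> complex"
begin

lemma functional_as_sum:
  assumes "Polynomial.degree f < N"
  shows "L f = (\<Sum>k<N. coeff f k * L (Polynomial.monom 1 k))"
proof -
  have "f = (\<Sum>k<N. Polynomial.smult (coeff f k) (Polynomial.monom 1 k))"
    using assms by (intro poly_eqI) (auto simp: coeff_sum coeff_eq_0 if_distrib[of "\<lambda>x. _ * x"] cong: if_cong)
  then have "L f = L (\<Sum>k<N. Polynomial.smult (coeff f k) (Polynomial.monom 1 k))"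
    by (rule arg_cong)
  then show ?thesis by (simp only: functional_sum functional_smult)
qed

lemma integral_all_prod_poly_at:
  "integral_all L m (\<Prod>i<m. poly_at (f i) i) = (\<Prod>i<m. L (f i))"
proof -
  define N where "N = Suc (\<Sum>i<m. Polynomial.degree (f i))"
  have N: "Polynomial.degree (f i) < N" if "i < m" for i
    using that member_le_sum[of i "{..<m}" "\<lambda>i. Polynomial.degree (f i)"] by (simp add: N_def)
  have "integral_all L m (\<Prod>i<m. poly_at (f i) i) =
    (\<Sum>\<kappa>\<in>{..<m} \<rightarrow>\<^sub>E {..<N}. (\<Prod>i<m. coeff (f i) (\<kappa> i) * L (Polynomial.monom 1 (\<kappa> i))))"
    by (simp add: prod_poly_at_as_sum[of m f N] N integral_all_sum integral_all_single
        lookup_exponent prod.distrib)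
  also have "\<dots> = (\<Prod>i<m. \<Sum>k<N. coeff (f i) k * L (Polynomial.monom 1 k))"
    by (rule prod_sum_PiE[symmetric]) auto
  also have "\<dots> = (\<Prod>i<m. L (f i))"
    by (intro prod.cong refl functional_as_sum[symmetric]) (simp add: N)
  finally show ?thesis .
qed

definition weight :: "nat \<Rightarrow> (nat \<Rightarrow> nat) \<Rightarrow> complex" where
  "weight m \<phi> = (\<Prod>i<m. w (\<phi> i))"

lemma weight_permute: "\<pi> permutes {..<m} \<Longrightarrow> weight m (\<phi> \<circ> \<pi>) = weight m \<phi>"
  using prod.permute[of \<pi> "{..<m}" "\<lambda>i. w (\<phi> i)"] by (simp add: weight_def comp_def)

text \<open>
  The one-variable orthogonal expansion in each variable. Both sides are additive in \<open>f\<close>, and for a monomial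
  the sum over \<open>\<phi>\<close> is the expanded product of the \<open>m\<close> one-variable expansions.
\<close>

lemma product_expansion:
  assumes f: "f \<in> degree_box n m" and mn: "m \<le> n"
  shows "f = (\<Sum>\<phi>\<in>{..<m} \<rightarrow>\<^sub>E {..<n}.
    Const (weight m \<phi> * integral_all L m (f * product_basis p m \<phi>)) * product_basis p m \<phi>)"
proof -
  let ?F = "{..<m} \<rightarrow>\<^sub>E {..<n}"
  let ?R = "\<lambda>f. \<Sum>\<phi>\<in>?F.
    Const (weight m \<phi> * integral_all L m (f * product_basis p m \<phi>)) * product_basis p m \<phi>"
  have mono: "?R (Poly_Mapping.single a c) = Poly_Mapping.single a c" if "a \<in> Poly_Mapping.keys f" for a c
  proof -
    define g where "g i = (Polynomial.monom 1 (Poly_Mapping.lookup a i) :: complex poly)" for i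
    have a: "Poly_Mapping.keys a \<subseteq> {..<m}" "\<And>i. i < m \<Longrightarrow> Poly_Mapping.lookup a i \<le> n - 1"
      using f that by (auto simp: degree_box_def)
    have single: "Poly_Mapping.single a c = Const c * (\<Prod>i<m. poly_at (g i) i)"
      unfolding g_def by (rule monomial_as_prod_poly_at[OF a(1)])
    have g: "g i = (\<Sum>k<n. Polynomial.smult (w k * L (g i * p k)) (p k))" if "i < m" for i
    proof (rule orthogonal_expansion)
      fix l assume "n \<le> l"
      then show "coeff (g i) l = 0" using a(2)[OF that] that mn by (auto simp: g_def)
    qed
    have int: "integral_all L m (Poly_Mapping.single a c * product_basis p m \<phi>) = c * (\<Prod>i<m. L (g i * p (\<phi> i)))" for \<phi>
      unfolding single product_basis_def mult.assoc integral_all_Const_mult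
        prod.distrib[symmetric] poly_at_mult[symmetric] integral_all_prod_poly_at ..
    have "?R (Poly_Mapping.single a c) =
      Const c * (\<Sum>\<phi>\<in>?F. \<Prod>i<m. Const (w (\<phi> i) * L (g i * p (\<phi> i))) * poly_at (p (\<phi> i)) i)"
      unfolding int sum_distrib_left
      by (intro sum.cong refl)
        (simp add: weight_def product_basis_def prod.distrib Const_hom.hom_mult Const_hom.hom_prod mult_ac)
    also have "\<dots> = Const c * (\<Prod>i<m. \<Sum>k<n. Const (w k * L (g i * p k)) * poly_at (p k) i)"
      by (simp add: prod_sum_PiE)
    also have "\<dots> = Const c * (\<Prod>i<m. poly_at (\<Sum>k<n. Polynomial.smult (w k * L (g i * p k)) (p k)) i)"
      by (simp only: poly_at_sum poly_at_smult)
    also have "\<dots> = Const c * (\<Prod>i<m. poly_at (g i) i)"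
      using g by (intro arg_cong[of _ _ "\<lambda>x. Const c * x"] prod.cong refl) simp
    finally show ?thesis using single by simp
  qed
  \<comment> \<open>Additivity reduces the expansion to the monomials of \<open>f\<close>.\<close>
  have R_sum: "?R (\<Sum>a\<in>A. h a) = (\<Sum>a\<in>A. ?R (h a))" for A and h :: "_ \<Rightarrow> cmpoly"
    unfolding sum_distrib_right integral_all_sum sum_distrib_left sum_Const_mult by (rule sum.swap)
  have "?R f = ?R (\<Sum>a\<in>Poly_Mapping.keys f. Poly_Mapping.single a (Poly_Mapping.lookup f a))"
    by (simp only: sum_monomials)
  also have "\<dots> = (\<Sum>a\<in>Poly_Mapping.keys f. Poly_Mapping.single a (Poly_Mapping.lookup f a))"
    unfolding R_sum by (intro sum.cong refl mono)
  finally show ?thesis by (simp only: sum_monomials)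
qed

lemma slater_in_antisym_space:
  assumes "\<phi> \<in> {..<m} \<rightarrow>\<^sub>E {..<n}"
  shows "slater p m \<phi> \<in> antisym_space n m"
proof -
  have "product_basis p m (\<phi> \<circ> \<sigma>) \<in> degree_box n m" if "\<sigma> permutes {..<m}" for \<sigma>
    unfolding product_basis_def
    by (rule degree_box_prod_poly_at)
      (use PiE_mem[OF PiE_comp_permutes[OF that assms]] in \<open>auto simp: degree_q\<close>)
  then have "slater p m \<phi> \<in> degree_box n m"
    unfolding slater_as_sum by (intro degree_box_sum degree_box_Const_mult) auto
  then show ?thesis by (simp add: antisym_space_iff subst_slater)
qed

definition antisym_pairing :: "nat \<Rightarrow> cmpoly \<Rightarrow> cmpoly \<Rightarrow> complex" where
  "antisym_pairing m f g = integral_all L m (f * g) / fact m"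

lemma integral_permuted_basis:
  assumes f: "f \<in> antisym_space n m" and \<sigma>: "\<sigma> permutes {..<m}"
  shows "integral_all L m (f * product_basis p m (\<phi> \<circ> \<sigma>)) =
    of_int (sign \<sigma>) * integral_all L m (f * product_basis p m \<phi>)"
proof -
  have "integral_all L m (f * product_basis p m (\<phi> \<circ> \<sigma>)) =
      integral_all L m (subst (\<lambda>i. Var (\<sigma> i)) (f * product_basis p m (\<phi> \<circ> \<sigma>)))"
    by (rule integral_all_permute[OF \<sigma>, symmetric])
  also have "\<dots> = integral_all L m (Const (of_int (sign \<sigma>)) * (f * product_basis p m \<phi>))"
    using f \<sigma> by (simp add: subst_mult subst_product_basis antisym_space_iff Const_hom.hom_of_int mult.assoc)
  finally show ?thesis by (simp only: integral_all_Const_mult)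
qed

text \<open>
  Against an antisymmetric \<open>f\<close>, all \<open>m!\<close> terms of the alternant have the same integral; this cancels the
  factor \<open>1 / m!\<close> of the pairing.
\<close>

lemma antisym_pairing_slater:
  assumes f: "f \<in> antisym_space n m"
  shows "antisym_pairing m f (slater p m \<phi>) = integral_all L m (f * product_basis p m \<phi>)"
proof -
  have "integral_all L m (f * slater p m \<phi>) =
      (\<Sum>\<sigma> | \<sigma> permutes {..<m}. of_int (sign \<sigma>) * integral_all L m (f * product_basis p m (\<phi> \<circ> \<sigma>)))"
    unfolding slater_as_sum sum_distrib_left integral_all_sum mult.left_commute[of f]
      integral_all_Const_mult ..
  also have "\<dots> = (\<Sum>\<sigma> | \<sigma> permutes {..<m}. integral_all L m (f * product_basis p m \<phi>))"
    by (intro sum.cong refl)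
      (simp add: integral_permuted_basis[OF f] mult.assoc[symmetric] of_int_mult[symmetric]
        sign_idempotent del: of_int_mult)
  also have "\<dots> = fact m * integral_all L m (f * product_basis p m \<phi>)"
    by (simp add: card_permutations[of "{..<m}" m])
  finally show ?thesis by (simp add: antisym_pairing_def)
qed

text \<open>
  Average the product expansion of \<open>f\<close> over all permutations of the index map \<open>\<phi>\<close>. Since \<open>f\<close> is
  antisymmetric, its coefficients are so as well, and the permuted products assemble to alternants.
\<close>

lemma slater_expansion:
  assumes f: "f \<in> antisym_space n m" and mn: "m \<le> n"
  shows "f = (\<Sum>\<phi>\<in>{..<m} \<rightarrow>\<^sub>E {..<n}.
    Const (weight m \<phi> / fact m * antisym_pairing m f (slater p m \<phi>)) * slater p m \<phi>)"
proof -
  let ?F = "{..<m} \<rightarrow>\<^sub>E {..<n}" and ?S = "{\<pi>. \<pi> permutes {..<m}}"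
  let ?t = "\<lambda>\<phi>. Const (weight m \<phi> * integral_all L m (f * product_basis p m \<phi>)) * product_basis p m \<phi>"
  have expand: "Const (weight m \<phi> * antisym_pairing m f (slater p m \<phi>)) * slater p m \<phi> =
      (\<Sum>\<sigma>\<in>?S. ?t (\<phi> \<circ> \<sigma>))" for \<phi>
    unfolding antisym_pairing_slater[OF f]
    unfolding slater_as_sum[of p m \<phi>] sum_distrib_left
  proof (rule sum.cong[OF refl])
    fix \<sigma> assume "\<sigma> \<in> ?S"
    then show "Const (weight m \<phi> * integral_all L m (f * product_basis p m \<phi>)) *
       (Const (of_int (sign \<sigma>)) * product_basis p m (\<phi> \<circ> \<sigma>)) = ?t (\<phi> \<circ> \<sigma>)"
      by (simp add: integral_permuted_basis[OF f] weight_permute Const_hom.hom_mult mult_ac)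
  qed
  have "(\<Sum>\<phi>\<in>?F. Const (weight m \<phi> * antisym_pairing m f (slater p m \<phi>)) * slater p m \<phi>) =
      (\<Sum>\<sigma>\<in>?S. \<Sum>\<phi>\<in>?F. ?t (\<phi> \<circ> \<sigma>))"
    unfolding expand by (rule sum.swap)
  also have "\<dots> = (\<Sum>\<sigma>\<in>?S. \<Sum>\<phi>\<in>?F. ?t \<phi>)"
  proof (rule sum.cong[OF refl])
    fix \<sigma> assume "\<sigma> \<in> ?S"
    then show "(\<Sum>\<phi>\<in>?F. ?t (\<phi> \<circ> \<sigma>)) = (\<Sum>\<phi>\<in>?F. ?t \<phi>)"
      by (intro sum_PiE_permute[where h = ?t]) simp
  qed
  also have "(\<Sum>\<phi>\<in>?F. ?t \<phi>) = f"
    using product_expansion[of f n m] f mn by (simp add: antisym_space_iff)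
  also have "(\<Sum>\<sigma>\<in>?S. f) = Const (fact m) * f"
    by (simp add: card_permutations[of "{..<m}" m] Const_hom.hom_of_nat[symmetric])
  finally have "Const (1 / fact m) * (Const (fact m) * f) =
      Const (1 / fact m) * (\<Sum>\<phi>\<in>?F. Const (weight m \<phi> * antisym_pairing m f (slater p m \<phi>)) * slater p m \<phi>)"
    by simp
  then show ?thesis
    by (simp add: sum_distrib_left mult.assoc[symmetric] Const_hom.hom_mult[symmetric])
qed

end

section \<open>The multivariable Christoffel--Darboux kernel\<close>

lemma Var_inject: "Var i = Var j \<Longrightarrow> i = j"
proof -
  assume eq: "Var i = Var j"
  have "Poly_Mapping.keys (Var k) = {Poly_Mapping.single k 1}" for k
    by (simp add: Var_def)
  with eq have "(Poly_Mapping.single i 1 :: nat \<Rightarrow>\<^sub>0 nat) = Poly_Mapping.single j 1"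
    by (metis singleton_inject)
  then show "i = j"
    by (metis lookup_single_eq lookup_single_not_eq zero_neq_one)
qed

lemma vandermonde_nonzero: "vandermonde s m \<noteq> 0"
  by (auto simp: vandermonde_def dest: Var_inject)

lemma shift_vars_vandermonde: "shift_vars s (vandermonde 0 m) = vandermonde s m"
  by (simp add: shift_vars_def vandermonde_def subst_hom.hom_prod subst_hom.hom_minus)

lemma shift_vars_slater:
  "shift_vars s (slater p m \<phi>) = det (mat m m (\<lambda>(i, j). poly_at (p (\<phi> i)) (s + j)))"
  unfolding shift_vars_def slater_def
  by (subst subst_hom.hom_det[symmetric], intro arg_cong[of _ _ det] eq_matI)
    (auto simp: subst_poly_at)

lemma vandermonde_dvd_slater: "vandermonde 0 m dvd slater p m \<phi>"
  using vandermonde_dvd_det[where m = m and x = Var and f = "\<lambda>i. map_poly Const (p (\<phi> i))"]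
  by (simp add: vandermonde_def slater_def poly_at_def)

context complex_orthogonal_system
begin

text \<open>
  The determinant \<open>det (K(x\<^sub>i, y\<^sub>k))\<close>, written as a sum of separated products.
\<close>

definition antisym_kernel :: "nat \<Rightarrow> nat \<Rightarrow> cmpoly" where
  "antisym_kernel n m = (\<Sum>\<phi>\<in>{..<m} \<rightarrow>\<^sub>E {..<n}.
    Const (weight m \<phi> / fact m) * (slater p m \<phi> * shift_vars m (slater p m \<phi>)))"

lemma antisym_space_polynomials_in: "f \<in> antisym_space n m \<Longrightarrow> f \<in> polynomials_in m"
  using degree_box_subset_polynomials_in antisym_space_iff by blast

lemma antisym_pairing_commute: "antisym_pairing m f g = antisym_pairing m g f"
  by (simp add: antisym_pairing_def mult.commute)

lemma multi_functional_separable: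
  assumes "g \<in> antisym_space n m" "h \<in> antisym_space n m" "f \<in> antisym_space n m"
  shows "multi_functional L m m (shift_vars m f * (g * shift_vars m h)) = Const (antisym_pairing m f h) * g"
proof -
  have "multi_functional L m m (g * shift_vars m (f * h)) = g * Const (integral_all L m (f * h) / fact m)"
    using assms by (intro multi_functional_split polynomials_in_mult antisym_space_polynomials_in)
  then show ?thesis
    by (simp add: antisym_pairing_def shift_vars_def subst_mult mult_ac)
qed

lemma antisym_tensorI:
  assumes "finite I" "\<And>i. i \<in> I \<Longrightarrow> g i \<in> antisym_space n m" "\<And>i. i \<in> I \<Longrightarrow> h i \<in> antisym_space n m"
  shows "(\<Sum>i\<in>I. g i * shift_vars m (h i)) \<in> antisym_tensor n m"
proof -
  \<comment> \<open>The tensor square is defined through sums over an initial segment of the naturals.\<close>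
  obtain e where e: "bij_betw e {..<card I} I"
    using ex_bij_betw_nat_finite[OF assms(1)] by (auto simp: atLeast0LessThan)
  have "(\<Sum>i\<in>I. g i * shift_vars m (h i)) = (\<Sum>k<card I. g (e k) * shift_vars m (h (e k)))"
    by (rule sum.reindex_bij_betw[OF e, symmetric])
  moreover have "\<forall>k<card I. g (e k) \<in> antisym_space n m \<and> h (e k) \<in> antisym_space n m"
    using assms(2,3) bij_betwE[OF e] by auto
  ultimately show ?thesis
    unfolding antisym_tensor_def by (intro CollectI exI[of _ "card I"] exI[of _ "g \<circ> e"] exI[of _ "h \<circ> e"]) simp
qed

lemma antisym_kernel_in_tensor: "antisym_kernel n m \<in> antisym_tensor n m"
proof -
  have "antisym_kernel n m = (\<Sum>\<phi>\<in>{..<m} \<rightarrow>\<^sub>E {..<n}.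
    (Const (weight m \<phi> / fact m) * slater p m \<phi>) * shift_vars m (slater p m \<phi>))"
    by (simp add: antisym_kernel_def mult.assoc)
  then show ?thesis
    using antisym_tensorI[of "{..<m} \<rightarrow>\<^sub>E {..<n}" "\<lambda>\<phi>. Const (weight m \<phi> / fact m) * slater p m \<phi>" n m "slater p m"]
    by (simp add: finite_PiE antisym_space_Const_mult slater_in_antisym_space)
qed

lemma antisym_kernel_reproduces:
  assumes f: "f \<in> antisym_space n m" and mn: "m \<le> n"
  shows "multi_functional L m m (shift_vars m f * antisym_kernel n m) = f"
proof -
  have "multi_functional L m m (shift_vars m f * antisym_kernel n m) =
    (\<Sum>\<phi>\<in>{..<m} \<rightarrow>\<^sub>E {..<n}. multi_functional L m m
      (shift_vars m f * ((Const (weight m \<phi> / fact m) * slater p m \<phi>) * shift_vars m (slater p m \<phi>))))"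
    by (simp add: antisym_kernel_def sum_distrib_left multi_functional_sum mult.assoc)
  also have "\<dots> = (\<Sum>\<phi>\<in>{..<m} \<rightarrow>\<^sub>E {..<n}.
      Const (antisym_pairing m f (slater p m \<phi>)) * (Const (weight m \<phi> / fact m) * slater p m \<phi>))"
    by (rule sum.cong[OF refl], rule multi_functional_separable[OF
          antisym_space_Const_mult[OF slater_in_antisym_space] slater_in_antisym_space f])
  also have "\<dots> = (\<Sum>\<phi>\<in>{..<m} \<rightarrow>\<^sub>E {..<n}.
      Const (weight m \<phi> / fact m * antisym_pairing m f (slater p m \<phi>)) * slater p m \<phi>)"
    by (intro sum.cong refl) (simp only: Const_hom.hom_mult mult_ac)
  also have "\<dots> = f" by (rule slater_expansion[OF f mn, symmetric])
  finally show ?thesis .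
qed

text \<open>
  Let \<open>E = \<Sum> g\<^sub>k(x) h\<^sub>k(y)\<close> be reproducing. Expanding each \<open>h\<^sub>k\<close> in the alternants \<open>D\<^sub>\<phi>\<close> turns
  \<open>E\<close> into a sum of \<open>(\<Sum>\<^sub>k \<langle>D\<^sub>\<phi>, h\<^sub>k\<rangle> g\<^sub>k(x)) D\<^sub>\<phi>(y)\<close> with weights, and the inner sum is
  \<open>D\<^sub>\<phi>(x)\<close> by the reproducing property of \<open>E\<close> itself.
\<close>

lemma reproducing_kernel_unique:
  assumes E: "reproducing_kernel L n m E" and mn: "m \<le> n"
  shows "E = antisym_kernel n m"
proof -
  let ?F = "{..<m} \<rightarrow>\<^sub>E {..<n}" and ?D = "slater p m"
  let ?c = "\<lambda>\<phi>. weight m \<phi> / fact m"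
  obtain N :: nat and g h where gh: "\<And>k. k < N \<Longrightarrow> g k \<in> antisym_space n m \<and> h k \<in> antisym_space n m"
    and E_eq: "E = (\<Sum>k<N. g k * shift_vars m (h k))"
    using E by (auto simp: reproducing_kernel_def antisym_tensor_def)
  have repr: "(\<Sum>k<N. Const (antisym_pairing m f (h k)) * g k) = f" if f: "f \<in> antisym_space n m" for f
  proof -
    have "f = multi_functional L m m (shift_vars m f * E)"
      using E f by (simp add: reproducing_kernel_def)
    also have "\<dots> = (\<Sum>k<N. multi_functional L m m (shift_vars m f * (g k * shift_vars m (h k))))"
      by (simp add: E_eq sum_distrib_left multi_functional_sum)
    also have "\<dots> = (\<Sum>k<N. Const (antisym_pairing m f (h k)) * g k)"
      using gh f by (intro sum.cong refl multi_functional_separable) auto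
    finally show ?thesis by simp
  qed
  have "E = (\<Sum>k<N. g k * shift_vars m (\<Sum>\<phi>\<in>?F. Const (?c \<phi> * antisym_pairing m (h k) (?D \<phi>)) * ?D \<phi>))"
    unfolding E_eq
    by (intro sum.cong refl arg_cong[of _ _ "\<lambda>f. _ * shift_vars m f"] slater_expansion mn) (simp add: gh)
  also have "\<dots> = (\<Sum>k<N. \<Sum>\<phi>\<in>?F. Const (?c \<phi>) *
      ((Const (antisym_pairing m (?D \<phi>) (h k)) * g k) * shift_vars m (?D \<phi>)))"
    unfolding shift_vars_def subst_hom.hom_sum sum_distrib_left
    by (intro sum.cong refl)
      (simp only: subst_mult subst_Const Const_hom.hom_mult antisym_pairing_commute[of m "h _"] mult_ac)
  also have "\<dots> = (\<Sum>\<phi>\<in>?F. Const (?c \<phi>) *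
      ((\<Sum>k<N. Const (antisym_pairing m (?D \<phi>) (h k)) * g k) * shift_vars m (?D \<phi>)))"
    by (subst sum.swap) (simp add: sum_distrib_left sum_distrib_right)
  also have "\<dots> = antisym_kernel n m"
    unfolding antisym_kernel_def
    by (intro sum.cong refl) (simp add: repr slater_in_antisym_space)
  finally show ?thesis .
qed

lemma reproducing_antisym_kernel: "m \<le> n \<Longrightarrow> reproducing_kernel L n m (antisym_kernel n m)"
  by (simp add: reproducing_kernel_def antisym_kernel_in_tensor antisym_kernel_reproduces)

lemma vandermondes_dvd_antisym_kernel: "vandermonde 0 m * vandermonde m m dvd antisym_kernel n m"
  unfolding antisym_kernel_def
proof (rule dvd_sum, rule dvd_mult, rule mult_dvd_mono[OF vandermonde_dvd_slater])
  fix \<phi>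
  obtain r where "slater p m \<phi> = vandermonde 0 m * r" using vandermonde_dvd_slater by (rule dvdE)
  then have "shift_vars m (slater p m \<phi>) = vandermonde m m * shift_vars m r"
    by (simp add: shift_vars_vandermonde[of m m, symmetric] shift_vars_def subst_mult)
  then show "vandermonde m m dvd shift_vars m (slater p m \<phi>)" by simp
qed

lemma CD_kernel_factor:
  assumes mn: "m \<le> n"
  shows "vandermonde 0 m * vandermonde m m * CD_kernel L n m = antisym_kernel n m"
proof -
  let ?V = "vandermonde 0 m * vandermonde m m"
  obtain K where K: "antisym_kernel n m = ?V * K"
    using vandermondes_dvd_antisym_kernel by (rule dvdE)
  have "CD_kernel L n m = K"
    unfolding CD_kernel_def
  proof (rule the_equality)
    show "reproducing_kernel L n m (?V * K)"
      using reproducing_antisym_kernel[OF mn] by (simp add: K)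
    fix K' assume "reproducing_kernel L n m (?V * K')"
    then have "?V * K' = ?V * K" using reproducing_kernel_unique[OF _ mn] K by simp
    then show "K' = K" by (simp add: vandermonde_nonzero)
  qed
  then show ?thesis by (simp add: K)
qed

text \<open>
  Integrated against its own diagonal term the alternant gives the product of the norms: every permutation other
  than the identity contributes a factor \<open>\<langle>p\<^sub>j, p\<^sub>k\<rangle> = 0\<close> with \<open>j \<noteq> k\<close>.
\<close>

lemma slater_nonzero: "slater p m (\<lambda>i. s + i) \<noteq> 0"
proof
  let ?\<phi> = "\<lambda>i. s + i"
  assume zero: "slater p m ?\<phi> = 0"
  have "integral_all L m (product_basis p m (?\<phi> \<circ> \<sigma>) * product_basis p m ?\<phi>) =
      (if \<sigma> = id then \<Prod>i<m. L (p (s + i) * p (s + i)) else 0)" if "\<sigma> permutes {..<m}" for \<sigma>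
  proof -
    have "integral_all L m (product_basis p m (?\<phi> \<circ> \<sigma>) * product_basis p m ?\<phi>) =
        (\<Prod>i<m. L (p (s + \<sigma> i) * p (s + i)))"
      by (simp add: product_basis_def prod.distrib[symmetric] poly_at_mult[symmetric] integral_all_prod_poly_at)
    also have "\<dots> = 0" if "\<sigma> \<noteq> id"
    proof -
      obtain i where i: "\<sigma> i \<noteq> i" using \<open>\<sigma> \<noteq> id\<close> by (auto simp: fun_eq_iff)
      then have "i < m" using permutes_not_in[OF \<open>\<sigma> permutes _\<close>, of i] by auto
      then show ?thesis using i by (intro prod_zero) (auto intro!: bexI[of _ i] orthogonal)
    qed
    finally show ?thesis
      using \<open>integral_all L m (product_basis p m (?\<phi> \<circ> \<sigma>) * product_basis p m ?\<phi>) = _\<close> by auto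
  qed
  note int = this
  have "integral_all L m (slater p m ?\<phi> * product_basis p m ?\<phi>) =
      (\<Sum>\<sigma> | \<sigma> permutes {..<m}. of_int (sign \<sigma>) *
        integral_all L m (product_basis p m (?\<phi> \<circ> \<sigma>) * product_basis p m ?\<phi>))"
    unfolding slater_as_sum sum_distrib_right integral_all_sum mult.assoc integral_all_Const_mult ..
  also have "\<dots> = (\<Sum>\<sigma> | \<sigma> permutes {..<m}. if \<sigma> = id then \<Prod>i<m. L (p (s + i) * p (s + i)) else 0)"
    by (intro sum.cong refl) (simp add: int)
  also have "\<dots> = (\<Prod>i<m. L (p (s + i) * p (s + i)))"
    by (simp add: finite_permutations permutes_id)
  also have "\<dots> \<noteq> 0"
    using inverse_norm by (metis (no_types, lifting) finite_lessThan mult_zero_right prod_zero_iff zero_neq_one)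
  finally show False using zero by simp
qed

end

section \<open>Specialisation to the diagonal\<close>

text \<open>
  Each pair \<open>k \<noteq> l\<close> occurs in both orders, so the product is the squared Vandermonde product with one sign
  per pair.
\<close>

lemma prod_differences_off_diagonal:
  fixes x :: "nat \<Rightarrow> 'a::comm_ring_1"
  shows "(\<Prod>k<m. \<Prod>l\<in>{..<m} - {k}. x k - x l) =
    (-1) ^ (m * (m - 1) div 2) * (\<Prod>j<m. \<Prod>i<j. x j - x i) ^ 2"
proof (induction m)
  case (Suc m)
  have row: "(\<Prod>l\<in>{..<Suc m} - {k}. x k - x l) = (x k - x m) * (\<Prod>l\<in>{..<m} - {k}. x k - x l)" if "k < m" for k
  proof -
    have "{..<Suc m} - {k} = insert m ({..<m} - {k})" using that by auto
    then show ?thesis by simp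
  qed
  have last: "{..<Suc m} - {m} = {..<m}" by auto
  have sgn: "(\<Prod>k<m. x k - x m) = (-1) ^ m * (\<Prod>k<m. x m - x k)"
  proof -
    have "(\<Prod>k<m. x k - x m) = (\<Prod>k<m. (-1) * (x m - x k))" by simp
    then show ?thesis by (simp only: prod.distrib prod_constant card_lessThan)
  qed
  have "Suc m * (Suc m - 1) = m * (m - 1) + 2 * m" by (cases m) auto
  then have e: "Suc m * (Suc m - 1) div 2 = m * (m - 1) div 2 + m" by simp
  have "(\<Prod>k<Suc m. \<Prod>l\<in>{..<Suc m} - {k}. x k - x l) =
    (\<Prod>k<m. x k - x m) * (\<Prod>k<m. \<Prod>l\<in>{..<m} - {k}. x k - x l) * (\<Prod>k<m. x m - x k)"
    by (simp add: last row prod.distrib)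
  also have "\<dots> = (-1) ^ (Suc m * (Suc m - 1) div 2) * (\<Prod>j<Suc m. \<Prod>i<j. x j - x i) ^ 2"
    unfolding e Suc.IH sgn by (simp add: power_add power2_eq_square mult_ac)
  finally show ?case .
qed simp

text \<open>
  The coefficientwise extension of \<open>L\<close>; through it the kernel identity applies with the variables
  themselves as points.
\<close>

definition extend_functional :: "(complex poly \<Rightarrow> complex) \<Rightarrow> cmpoly poly \<Rightarrow> cmpoly" where
  "extend_functional L g = (\<Sum>k\<le>Polynomial.degree g. coeff g k * Const (L (Polynomial.monom 1 k)))"

lemma extend_functional_superset:
  "Polynomial.degree g \<le> N \<Longrightarrow>
   extend_functional L g = (\<Sum>k\<le>N. coeff g k * Const (L (Polynomial.monom 1 k)))"
  unfolding extend_functional_def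
  by (rule sum.mono_neutral_left) (auto simp: coeff_eq_0)

lemma extend_functional_add: "extend_functional L (f + g) = extend_functional L f + extend_functional L g"
proof -
  let ?N = "max (Polynomial.degree f) (Polynomial.degree g)"
  have "Polynomial.degree (f + g) \<le> ?N" by (rule degree_add_le_max)
  then show ?thesis
    by (simp add: extend_functional_superset[of _ ?N] distrib_right sum.distrib)
qed

lemma extend_functional_smult: "extend_functional L (Polynomial.smult c f) = c * extend_functional L f"
  by (simp add: extend_functional_superset[of _ "Polynomial.degree f"] degree_smult_le
      sum_distrib_left mult.assoc)

context complex_orthogonal_system
begin

lemma extend_functional_Const: "extend_functional L (map_poly Const f) = Const (L f)"
  by (simp add: extend_functional_def functional_as_sum[of f "Suc (Polynomial.degree f)"]
      Const_hom.hom_sum Const_hom.hom_mult lessThan_Suc_atMost)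

sublocale extended: orthogonal_system "\<lambda>k. map_poly Const (p k)" "extend_functional L" "\<lambda>k. Const (w k)"
proof
  fix j k
  show "Polynomial.degree (map_poly Const (p k)) = k" by (simp add: degree_q)
  show "lead_coeff (map_poly Const (p k)) = 1"
    by (simp add: degree_q coeff_q)
  show "extend_functional L (map_poly Const (p j) * map_poly Const (p k)) = 0" if "j \<noteq> k"
    using orthogonal[OF that]
    by (simp add: map_poly_Const.hom_mult[symmetric] extend_functional_Const)
  show "Const (w k) * extend_functional L (map_poly Const (p k) * map_poly Const (p k)) = 1"
    using inverse_norm[of k]
    by (simp add: map_poly_Const.hom_mult[symmetric] extend_functional_Const Const_hom.hom_mult[symmetric])
qed (simp_all add: extend_functional_add extend_functional_smult)

lemma antisym_kernel_as_det:
  "antisym_kernel n m = det (mat m m (\<lambda>(i, k). extended.kernel n (Var i) (Var (m + k))))"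
proof -
  let ?F = "{..<m} \<rightarrow>\<^sub>E {..<n}"
  let ?u = "\<lambda>k j. Const (w k) * poly_at (p k) j" and ?v = "\<lambda>k j. poly_at (p k) (m + j)"
  have u: "det (mat m m (\<lambda>(i, j). ?u (\<phi> i) j)) = Const (weight m \<phi>) * slater p m \<phi>" for \<phi>
    unfolding slater_def weight_def det_rows_as_sum[of m ?u] det_rows_as_sum[of m "\<lambda>k. poly_at (p k)"]
    by (simp add: prod.distrib sum_distrib_left Const_hom.hom_prod mult_ac)
  have "Const (fact m) * antisym_kernel n m =
      (\<Sum>\<phi>\<in>?F. Const (weight m \<phi>) * (slater p m \<phi> * shift_vars m (slater p m \<phi>)))"
    unfolding antisym_kernel_def sum_distrib_left
    by (intro sum.cong refl) (simp add: mult.assoc[symmetric] Const_hom.hom_mult[symmetric])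
  also have "\<dots> = (\<Sum>\<phi>\<in>?F. det (mat m m (\<lambda>(i, j). ?u (\<phi> i) j)) * det (mat m m (\<lambda>(i, j). ?v (\<phi> i) j)))"
    by (simp add: u shift_vars_slater mult.assoc)
  also have "\<dots> = of_nat (fact m) * det (mat m m (\<lambda>(i, j). \<Sum>k<n. ?u k i * ?v k j))"
    by (rule cauchy_binet_functions)
  also have "of_nat (fact m) = Const (fact m)"
    by (metis Const_hom.hom_of_nat of_nat_fact)
  finally have "antisym_kernel n m = det (mat m m (\<lambda>(i, j). \<Sum>k<n. ?u k i * ?v k j))"
    by simp
  then show ?thesis by (simp add: extended.kernel_def poly_at_def)
qed

text \<open>
  The points are now independent variables. Then the common factor of both sides of \<open>kernel_det_identity\<close> is
  the alternant of \<open>p\<^bsub>n-m\<^esub>, \<dots>, p\<^bsub>n-1\<^esub>\<close>, which is not zero and can be cancelled.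
\<close>

lemma christoffel_darboux:
  assumes mn: "m \<le> n"
  shows "Const (\<Prod>l<m. w (n - m + l)) *
      det (mat (2 * m) (2 * m) (\<lambda>(i, j). poly_at (p (n - m + j)) i)) =
    (\<Prod>k<m. \<Prod>l<m. Var (m + k) - Var l) * antisym_kernel n m"
proof -
  let ?D = "slater p m (\<lambda>l. n - m + l)"
  let ?M = "mat (2 * m) (2 * m) (\<lambda>(i, j). poly_at (p (n - m + j)) i)"
  have D: "det (mat m m (\<lambda>(l, k). poly (map_poly Const (p (n - m + l))) (Var k))) = ?D"
    by (simp add: slater_def poly_at_def)
  have "transpose_mat ?M = mat (2 * m) (2 * m)
      (\<lambda>(j, k). poly (map_poly Const (p (n - m + j))) (if k < m then Var k else Var (m + (k - m))))"
    by (rule eq_matI) (auto simp: poly_at_def)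
  then have F: "det (mat (2 * m) (2 * m)
      (\<lambda>(j, k). poly (map_poly Const (p (n - m + j))) (if k < m then Var k else Var (m + (k - m))))) = det ?M"
    using det_transpose[of ?M "2 * m"] by simp
  \<comment> \<open>The alternant is put in front of both sides, to be cancelled.\<close>
  have "?D * (Const (\<Prod>l<m. w (n - m + l)) * det ?M) =
      ?D * ((\<Prod>k<m. \<Prod>l<m. Var (m + k) - Var l) * antisym_kernel n m)"
    using extended.kernel_det_identity[OF mn, of Var "\<lambda>k. Var (m + k)"]
    unfolding D F antisym_kernel_as_det[symmetric] by (simp add: Const_hom.hom_prod mult_ac)
  then show ?thesis using slater_nonzero[of m "n - m"] by simp
qed

end

text \<open>
  The divided difference \<open>r\<close> is found by recursion on the coefficients: for \<open>a + t f(t)\<close> the difference is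
  \<open>y f(y) - x f(x) = (y - x) f(y) + x (f(y) - f(x))\<close>. On the diagonal this is the product rule.
\<close>

lemma divided_difference:
  assumes "i < m"
  shows "\<exists>r. poly_at f (m + i) - poly_at f i = (Var (m + i) - Var i) * r \<and>
    diag m r = poly_at (pderiv f) i"
proof (induction f)
  case (pCons a f)
  then obtain r where "poly_at f (m + i) - poly_at f i = (Var (m + i) - Var i) * r"
    and d: "diag m r = poly_at (pderiv f) i" by blast
  then have r: "poly_at f (m + i) = poly_at f i + (Var (m + i) - Var i) * r"
    by (simp only: diff_eq_eq add.commute)
  have "diag m (poly_at f (m + i) + Var i * r) = poly_at (pderiv (pCons a f)) i"
    using assms d
    by (simp add: diag_def subst_add subst_mult subst_poly_at[where j = i] pderiv_pCons poly_at_add poly_at_pCons)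
  moreover have "poly_at (pCons a f) (m + i) - poly_at (pCons a f) i =
      (Var (m + i) - Var i) * (poly_at f (m + i) + Var i * r)"
    unfolding poly_at_pCons r by (simp add: algebra_simps)
  ultimately show ?case by blast
qed (auto intro!: exI[of _ 0] simp: diag_def)

text \<open>
  The matrix with rows \<open>x\<^sub>i\<close> and \<open>y\<^sub>i\<close> is \<open>T A\<close>, where \<open>A\<close> has divided differences in place of the rows
  \<open>y\<^sub>i\<close>, and the lower triangular matrix \<open>T\<close> adds row \<open>x\<^sub>i\<close> to \<open>y\<^sub>i - x\<^sub>i\<close> times the corresponding row
  of \<open>A\<close>.
\<close>

lemma det_confluent:
  "\<exists>d. det (mat (2 * m) (2 * m) (\<lambda>(i, j). poly_at (p (n - m + j)) i)) =
       (\<Prod>i<m. Var (m + i) - Var i) * d \<and> diag m d = det (confluent_matrix p n m)"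
proof -
  define r where "r i j = (SOME r. poly_at (p (n - m + j)) (m + i) - poly_at (p (n - m + j)) i =
    (Var (m + i) - Var i) * r \<and> diag m r = poly_at (pderiv (p (n - m + j))) i)" for i j
  have diff: "poly_at (p (n - m + j)) (m + i) - poly_at (p (n - m + j)) i = (Var (m + i) - Var i) * r i j"
    and dr: "diag m (r i j) = poly_at (pderiv (p (n - m + j))) i" if "i < m" for i j
    using someI_ex[OF divided_difference[OF that, of "p (n - m + j)"]] unfolding r_def by blast+
  have r: "poly_at (p (n - m + j)) (m + i) = poly_at (p (n - m + j)) i + (Var (m + i) - Var i) * r i j"
    if "i < m" for i j
    using diff[OF that, of j] by (simp only: diff_eq_eq add.commute)
  define A where "A = mat (2 * m) (2 * m) (\<lambda>(i, j). if i < m then poly_at (p (n - m + j)) i else r (i - m) j)"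
  define T where "T = mat (2 * m) (2 * m) (\<lambda>(i, j). if i = j then if i < m then 1 else Var i - Var (i - m)
      else if i = m + j then 1 else 0)"
  have T_dim: "T \<in> carrier_mat (2 * m) (2 * m)" and A_dim: "A \<in> carrier_mat (2 * m) (2 * m)"
    by (auto simp: T_def A_def)
  have T_row: "(\<Sum>k<2 * m. T $$ (i, k) * A $$ (k, j)) = poly_at (p (n - m + j)) i"
    if ij: "i < 2 * m" "j < 2 * m" for i j
  proof (cases "i < m")
    case True
    have "(\<Sum>k<2 * m. T $$ (i, k) * A $$ (k, j)) = (\<Sum>k<2 * m. if k = i then A $$ (k, j) else 0)"
      using True by (intro sum.cong) (auto simp: T_def)
    then show ?thesis using True ij by (simp add: A_def)
  next
    case False
    then obtain i' where i': "i = m + i'" "i' < m"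
      using ij le_Suc_ex[of m i] by auto
    have "(\<Sum>k<2 * m. T $$ (i, k) * A $$ (k, j)) =
        (\<Sum>k<2 * m. (if k = i' then A $$ (k, j) else 0) + (if k = i then (Var i - Var i') * A $$ (k, j) else 0))"
      using i' by (intro sum.cong) (auto simp: T_def)
    also have "\<dots> = A $$ (i', j) + (Var i - Var i') * A $$ (i, j)"
      using i' by (simp add: sum.distrib)
    finally show ?thesis using i' ij r[of i' j] by (simp add: A_def)
  qed
  have "mat (2 * m) (2 * m) (\<lambda>(i, j). poly_at (p (n - m + j)) i) = T * A"
  proof (rule eq_matI)
    fix i j assume ij: "i < dim_row (T * A)" "j < dim_col (T * A)"
    then have "(T * A) $$ (i, j) = (\<Sum>k<2 * m. T $$ (i, k) * A $$ (k, j))"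
      by (simp add: T_def A_def scalar_prod_def atLeast0LessThan)
    then show "mat (2 * m) (2 * m) (\<lambda>(i, j). poly_at (p (n - m + j)) i) $$ (i, j) = (T * A) $$ (i, j)"
      using ij T_row[of i j] by (simp add: T_def A_def)
  qed (auto simp: T_def A_def)
  then have "det (mat (2 * m) (2 * m) (\<lambda>(i, j). poly_at (p (n - m + j)) i)) = det T * det A"
    by (simp only: det_mult[OF T_dim A_dim])
  also have "det T = (\<Prod>i<2 * m. if i < m then 1 else Var i - Var (i - m))"
    by (subst det_lower_triangular[of "2 * m"]) (auto simp: T_def prod_list_diag_prod atLeast0LessThan intro!: prod.cong)
  also have "\<dots> = (\<Prod>i<m. Var (m + i) - Var i)"
  proof -
    have prod_add: "(\<Prod>i<a + b. f i) = (\<Prod>i<a. f i) * (\<Prod>i<b. f (a + i))" for a b and f :: "nat \<Rightarrow> cmpoly"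
      by (induction b) (simp_all add: mult.assoc)
    show ?thesis by (simp add: mult_2 prod_add)
  qed
  finally have "det (mat (2 * m) (2 * m) (\<lambda>(i, j). poly_at (p (n - m + j)) i)) =
      (\<Prod>i<m. Var (m + i) - Var i) * det A" .
  moreover have "diag m (det A) = det (confluent_matrix p n m)"
  proof -
    have "map_mat (diag m) A = confluent_matrix p n m"
      by (rule eq_matI) (auto simp: A_def confluent_matrix_def dr, auto simp: diag_def subst_poly_at)
    then have "det (confluent_matrix p n m) = det (map_mat (diag m) A)" by (rule arg_cong[OF sym])
    also have "\<dots> = diag m (det A)"
      unfolding diag_def by (rule subst_hom.hom_det)
    finally show ?thesis by (rule sym)
  qed
  ultimately show ?thesis by blast
qed

lemma diag_vandermonde:
  "diag m (vandermonde 0 m) = vandermonde 0 m" "diag m (vandermonde m m) = vandermonde 0 m"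
  by (auto simp: diag_def vandermonde_def subst_hom.hom_prod subst_hom.hom_minus intro!: prod.cong)

lemma (in complex_orthogonal_system) confluent_christoffel_darboux:
  assumes mn: "m \<le> n"
  shows "Const (\<Prod>l<m. w (n - m + l)) * det (confluent_matrix p n m) =
    (-1) ^ (m * (m - 1) div 2) * vandermonde 0 m ^ 4 * diag m (CD_kernel L n m)"
proof -
  let ?W = "Const (\<Prod>l<m. w (n - m + l))"
  obtain d where d: "det (mat (2 * m) (2 * m) (\<lambda>(i, j). poly_at (p (n - m + j)) i)) =
       (\<Prod>i<m. Var (m + i) - Var i) * d" "diag m d = det (confluent_matrix p n m)"
    using det_confluent by blast
  have split: "(\<Prod>k<m. \<Prod>l<m. Var (m + k) - Var l) =
      (\<Prod>k<m. Var (m + k) - Var k) * (\<Prod>k<m. \<Prod>l\<in>{..<m} - {k}. Var (m + k) - Var l)"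
    unfolding prod.distrib[symmetric] by (intro prod.cong refl) (simp add: prod.remove)
  have nz: "(\<Prod>k<m. Var (m + k) - Var k) \<noteq> 0"
    by (auto dest: Var_inject)
  have "(\<Prod>k<m. Var (m + k) - Var k) * (?W * d) =
      (\<Prod>k<m. Var (m + k) - Var k) * ((\<Prod>k<m. \<Prod>l\<in>{..<m} - {k}. Var (m + k) - Var l) *
        (vandermonde 0 m * vandermonde m m * CD_kernel L n m))"
    using christoffel_darboux[OF mn] unfolding d(1) split CD_kernel_factor[OF mn] by (simp only: mult_ac)
  then have "?W * d = (\<Prod>k<m. \<Prod>l\<in>{..<m} - {k}. Var (m + k) - Var l) *
        (vandermonde 0 m * vandermonde m m * CD_kernel L n m)"
    using nz by simp
  then have "diag m (?W * d) = diag m ((\<Prod>k<m. \<Prod>l\<in>{..<m} - {k}. Var (m + k) - Var l) *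
        (vandermonde 0 m * vandermonde m m * CD_kernel L n m))"
    by simp
  moreover have "diag m (\<Prod>k<m. \<Prod>l\<in>{..<m} - {k}. Var (m + k) - Var l) =
      (\<Prod>k<m. \<Prod>l\<in>{..<m} - {k}. Var k - Var l)"
    by (auto simp: diag_def subst_hom.hom_prod subst_hom.hom_minus intro!: prod.cong)
  ultimately have "?W * diag m d = (\<Prod>k<m. \<Prod>l\<in>{..<m} - {k}. Var k - Var l) *
        (vandermonde 0 m * vandermonde 0 m * diag m (CD_kernel L n m))"
    using diag_vandermonde[of m] by (simp add: diag_def subst_mult)
  then show ?thesis
    unfolding d(2) prod_differences_off_diagonal
    by (simp add: vandermonde_def power2_eq_square power4_eq_xxxx mult_ac)
qed

text \<open>
  The norms do not vanish: if \<open>p\<^sub>k\<close> were isotropic, it would be orthogonal to all of \<open>p\<^sub>0, \<dots>, p\<^sub>k\<close>, hence to the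
  whole space \<open>V\<^bsub>k+1\<^esub>\<close> that they span.
\<close>

lemma complex_orthogonal_systemI:
  assumes lin: "linear_functional L" and nondeg: "nondegenerate L" and orth: "monic_orthogonal L p"
  shows "complex_orthogonal_system p L (\<lambda>k. 1 / L (p k * p k))"
proof -
  have "Polynomial.degree (p k) = k" and "lead_coeff (p k) = 1" for k
    using orth unfolding monic_orthogonal_def by blast+
  then interpret monic_system p by unfold_locales
  from lin have lin': "Vector_Spaces.linear Polynomial.smult (*) L"
    by (simp add: linear_functional_def)
  have add: "L (f + g) = L f + L g" and smult: "L (Polynomial.smult c f) = c * L f" for f g c
    using lin' by (simp_all add: Vector_Spaces.linear_iff)
  have L_sum: "L (\<Sum>k\<in>A. f k) = (\<Sum>k\<in>A. L (f k))" for A :: "nat set" and f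
    using smult[of 0 0] by (induction A rule: infinite_finite_induct) (simp_all add: add)
  have orthogonal: "L (p j * p k) = 0" if "j \<noteq> k" for j k
    using orth that by (simp add: monic_orthogonal_def pairing_def)
  have "L (p k * p k) \<noteq> 0" for k
  proof
    assume zero: "L (p k * p k) = 0"
    have "pairing L (p k) g = 0" if "g \<in> poly_space (Suc k)" for g
    proof -
      have "\<exists>c. g = (\<Sum>j<Suc k. Polynomial.smult (c j) (p j))"
        using that by (intro spanned_by_q) (auto simp: poly_space_def coeff_eq_0)
      then obtain c where c: "g = (\<Sum>j<Suc k. Polynomial.smult (c j) (p j))" by blast
      have "L (p k * p j) = 0" for j using zero orthogonal[of k j] by (cases "j = k") auto
      then show ?thesis
        by (simp only: pairing_def c sum_distrib_left mult_smult_right L_sum smult) simp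
    qed
    moreover have "p k \<in> poly_space (Suc k)" by (simp add: poly_space_def degree_q)
    moreover have "p k \<noteq> 0" using monic_q[of k] by auto
    ultimately show False using nondeg by (auto simp: nondegenerate_def)
  qed
  then show ?thesis by unfold_locales (simp_all add: add smult orthogonal)
qed

lemma to_fract_power: "to_fract (x ^ k) = to_fract x ^ k"
  by (induction k) simp_all

theorem corollary2:
  fixes L :: "complex poly \<Rightarrow> complex"
    and p :: "nat \<Rightarrow> complex poly"
    and m n :: nat
  assumes "linear_functional L"
    and "nondegenerate L"
    and "monic_orthogonal L p"
    and "m \<le> n"
  shows "to_fract (diag m (CD_kernel L n m)) =
    (-1) ^ (m * (m - 1) div 2) /
      (to_fract (Const (\<Prod>i=1..m. pairing L (p (n - i)) (p (n - i)))) *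
       to_fract (vandermonde 0 m) ^ 4) *
    to_fract (det (confluent_matrix p n m))"
proof -
  interpret complex_orthogonal_system p L "\<lambda>k. 1 / L (p k * p k)"
    using assms(1-3) by (rule complex_orthogonal_systemI)
  \<comment> \<open>The statement counts the norms downwards from \<open>n - 1\<close>, the identities above upwards from \<open>n - m\<close>.\<close>
  let ?H = "\<Prod>i=1..m. pairing L (p (n - i)) (p (n - i))"
  let ?s = "(-1) ^ (m * (m - 1) div 2)"
  let ?V = "vandermonde 0 m" and ?K = "diag m (CD_kernel L n m)" and ?d = "det (confluent_matrix p n m)"
  have H_eq: "?H = (\<Prod>l<m. L (p (n - m + l) * p (n - m + l)))"
    unfolding pairing_def using \<open>m \<le> n\<close>
    by (intro prod.reindex_bij_witness[of _ "\<lambda>l. m - l" "\<lambda>i. m - i"]) auto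
  have norm: "L (p k * p k) \<noteq> 0" for k using inverse_norm[of k] by auto
  have H_nz: "?H \<noteq> 0" unfolding H_eq by (simp add: norm)
  have "(\<Prod>l<m. 1 / L (p (n - m + l) * p (n - m + l))) = 1 / ?H"
    unfolding H_eq prod_dividef by simp
  then have "Const ?H * (Const (1 / ?H) * ?d) = Const ?H * (?s * ?V ^ 4 * ?K)"
    using confluent_christoffel_darboux[OF \<open>m \<le> n\<close>] by simp
  then have "?d = Const ?H * (?s * ?V ^ 4 * ?K)"
    using H_nz by (simp add: mult.assoc[symmetric] Const_hom.hom_mult[symmetric])
  then have "?s * ?d = Const ?H * ?V ^ 4 * ?K"
    by (simp add: mult.assoc[symmetric] power_add[symmetric] mult_2[symmetric])
  then have "to_fract (?s * ?d) = to_fract (Const ?H * ?V ^ 4 * ?K)"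
    by (rule arg_cong)
  then have "?s * to_fract ?d = to_fract (Const ?H) * to_fract ?V ^ 4 * to_fract ?K"
    by (simp add: to_fract_power)
  moreover have "to_fract (Const ?H) * to_fract ?V ^ 4 \<noteq> 0"
    using H_nz vandermonde_nonzero by simp
  ultimately show ?thesis by (simp add: field_simps)
qed

end
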